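(* Let $M$ be a monoid. The functor $D_1\colon\mathrm{XSExt}_M\to can\text{-}\mathcal{S}\mathrm{mod}_M$ and its restriction $d_1\colon com\text{-}\mathrm{XSExt}_M\to can\text{-}\mathcal{S}\mathrm{mod}_M$ preserve finite products.
   Context: Monoids are written additively with neutral element $0$ and are not assumed commutative. $\mathbf{Mon}$ is the category of monoids (its regular epimorphisms are the surjective homomorphisms). A Schreier extension is a short exact sequence $K\xrightarrow{k}X\xrightarrow{f}M$ in $\mathbf{Mon}$ ($k$ is a kernel of $f$ and $f$ is a cokernel of $k$) such that for every $m\in M$ there is $u_m\in f^{-1}(m)$, called a representative of $m$, such that every $x\in f^{-1}(m)$ can be written as $x=k(a)+u_m$ for a unique $a\in K$. A morphism of Schreier extensions is a commutative diagram of homomorphisms between two such sequences whose middle component sends representatives to representatives. A crossed semimodule is a pair $(\delta\colon B\to C,\alpha)$ where $\delta$ is a homomorphism of monoids and $\alpha\colon C\to\mathrm{End}(B)$ is a monoid homomorphism (write $c\ast b=\alpha(c)(b)$) with $\delta(c\ast b)+c=c+\delta(b)$ and $\delta(b_1)\ast b_2+b_1=b_1+b_2$ for all $b,b_1,b_2\in B$, $c\in C$. A morphism $(\delta,\alpha)\to(\delta',\alpha')$ is a pair of homomorphisms $\varphi\colon B\to B'$, $\psi\colon C\to C'$ with $\delta'\varphi=\psi\delta$ and $\varphi(\alpha(c)(b))=\alpha'(\psi(c))(\varphi(b))$. A sequence $A\xrightarrow{k}B\xrightarrow{\delta}C\xrightarrow{\pi}M$ with $(\delta,\alpha)$ a crossed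 semimodule, $k$ a kernel and $\pi$ a cokernel of $\delta$, is a crossed Schreier extension if, for the (regular epimorphism, monomorphism) factorisation $\delta=\nu\rho$, $\rho\colon B\to N$, $\nu\colon N\to C$: ($\mathbf{CS}_r$) $N$ is right cancellative and $N\xrightarrow{\nu}C\xrightarrow{\pi}M$ is a Schreier extension; ($\mathbf{CS}_l$) $A$ is right cancellative and $A\xrightarrow{k}B\xrightarrow{\rho}N$ is a Schreier extension. Then $A$ is commutative and cancellative, $\alpha$ restricts to an action of $C$ on $A$, and there is a well-defined induced action $\beta\colon M\to\mathrm{End}(A)$, $\beta(m)(a)=\alpha(c)(a)$ for any $c\in C$ with $\pi(c)=m$. $\mathrm{XSExt}_M$ is the category of crossed Schreier extensions ending in $M$; a morphism is a morphism of crossed semimodules $(\varphi,\psi)$ with $\pi'\psi=\pi$ such that, with $\varphi^\star\colon A\to A'$ and $\psi^\star\colon N\to N'$ the induced maps, $(\varphi^\star,\varphi,\psi^\star)$ and $(\psi^\star,\psi,1_M)$ are morphisms of Schreier extensions between, respectively, $A\to B\to N$ and $A'\to B'\to N'$, and $N\to C\to M$ and $N'\to C'\to M$. $com\text{-}\mathrm{XSExt}_M$ is the full subcategory on the objects with $B$ commutative. $can\text{-}\mathcal{S}\mathrm{mod}_M$ is the category of pairs $(A,\beta)$ with $A$ a commutative cancellative monoid and $\beta\colon M\to\mathrm{End}(A)$ a monoid homomorphism, with action-preserving monoid homomorphisms. $D_1$ sends a crossed Schreier extension to $(A,\beta)$ and a morphism $(\varphi,\psi)$ to $\varphi^\star$;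 $d_1$ is its restriction to $com\text{-}\mathrm{XSExt}_M$. Finite products in $\mathrm{XSExt}_M$: the terminal object is $0\to 0\to M\xrightarrow{1_M}M$, and the product of $A\to B\xrightarrow{\delta}C\xrightarrow{\pi}M$ and $A'\to B'\xrightarrow{\delta'}C'\xrightarrow{\pi'}M$ is $A\times A'\to B\times B'\to C\times_M C'\to M$ with the componentwise maps and the componentwise action of $C\times_MC'$ on $B\times B'$; $com\text{-}\mathrm{XSExt}_M$ is closed under finite products. *)

theory Defs
  imports "HOL-Algebra.Divisibility"
begin

text \<open>
  Monoids are HOL-Algebra monoids with carriers in one type \<open>'u\<close>, which plays the role of the
  universe of sets: "for all monoids" ranges over \<open>'u monoid\<close>, and arbitrary cardinalities are
  covered because \<open>'u\<close> is a type variable.  The additive, non-commutative operation of the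
  mathematics is written \<open>\<otimes>\<close>, its neutral element \<open>\<one>\<close>.
\<close>

section \<open>Categories, functors, preservation of finite products\<close>

text \<open>
  Hom-sets are indexed by their end points and need not be disjoint, so composition, identities
  and the arrow part of a functor take the objects as arguments:
  \<open>Comp \<C> X Y Z g f\<close> is the composite of \<open>f : X \<rightarrow> Y\<close> and \<open>g : Y \<rightarrow> Z\<close>.
\<close>

record ('o, 'a) cat =
  Obj :: "'o set"
  Hom :: "'o \<Rightarrow> 'o \<Rightarrow> 'a set"
  Ident :: "'o \<Rightarrow> 'a"
  Comp :: "'o \<Rightarrow> 'o \<Rightarrow> 'o \<Rightarrow> 'a \<Rightarrow> 'a \<Rightarrow> 'a"

definition is_category :: "('o, 'a) cat \<Rightarrow> bool" where
  "is_category \<C> \<longleftrightarrow>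
     (\<forall>X \<in> Obj \<C>. Ident \<C> X \<in> Hom \<C> X X) \<and>
     (\<forall>X \<in> Obj \<C>. \<forall>Y \<in> Obj \<C>. \<forall>Z \<in> Obj \<C>. \<forall>f \<in> Hom \<C> X Y. \<forall>g \<in> Hom \<C> Y Z.
        Comp \<C> X Y Z g f \<in> Hom \<C> X Z) \<and>
     (\<forall>X \<in> Obj \<C>. \<forall>Y \<in> Obj \<C>. \<forall>f \<in> Hom \<C> X Y.
        Comp \<C> X X Y f (Ident \<C> X) = f \<and> Comp \<C> X Y Y (Ident \<C> Y) f = f) \<and>
     (\<forall>W \<in> Obj \<C>. \<forall>X \<in> Obj \<C>. \<forall>Y \<in> Obj \<C>. \<forall>Z \<in> Obj \<C>.
        \<forall>f \<in> Hom \<C> W X. \<forall>g \<in> Hom \<C> X Y. \<forall>h \<in> Hom \<C> Y Z.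
          Comp \<C> W X Z (Comp \<C> X Y Z h g) f = Comp \<C> W Y Z h (Comp \<C> W X Y g f))"

definition full_subcat :: "('o, 'a) cat \<Rightarrow> ('o \<Rightarrow> bool) \<Rightarrow> ('o, 'a) cat" where
  "full_subcat \<C> P = \<C>\<lparr>Obj := {X \<in> Obj \<C>. P X}\<rparr>"

record ('o, 'a, 'p, 'b) functor_data =
  FOb :: "'o \<Rightarrow> 'p"
  FAr :: "'o \<Rightarrow> 'o \<Rightarrow> 'a \<Rightarrow> 'b"

definition is_functor ::
  "('o, 'a) cat \<Rightarrow> ('p, 'b) cat \<Rightarrow> ('o, 'a, 'p, 'b) functor_data \<Rightarrow> bool" where
  "is_functor \<C> \<D> F \<longleftrightarrow>
     is_category \<C> \<and> is_category \<D> \<and>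
     (\<forall>X \<in> Obj \<C>. FOb F X \<in> Obj \<D>) \<and>
     (\<forall>X \<in> Obj \<C>. \<forall>Y \<in> Obj \<C>. \<forall>f \<in> Hom \<C> X Y. FAr F X Y f \<in> Hom \<D> (FOb F X) (FOb F Y)) \<and>
     (\<forall>X \<in> Obj \<C>. FAr F X X (Ident \<C> X) = Ident \<D> (FOb F X)) \<and>
     (\<forall>X \<in> Obj \<C>. \<forall>Y \<in> Obj \<C>. \<forall>Z \<in> Obj \<C>. \<forall>f \<in> Hom \<C> X Y. \<forall>g \<in> Hom \<C> Y Z.
        FAr F X Z (Comp \<C> X Y Z g f) =
          Comp \<D> (FOb F X) (FOb F Y) (FOb F Z) (FAr F Y Z g) (FAr F X Y f))"

definition is_product ::
  "('o, 'a) cat \<Rightarrow> 'i set \<Rightarrow> ('i \<Rightarrow> 'o) \<Rightarrow> 'o \<Rightarrow> ('i \<Rightarrow> 'a) \<Rightarrow> bool" where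
  "is_product \<C> I X P p \<longleftrightarrow>
     (\<forall>i \<in> I. X i \<in> Obj \<C>) \<and> P \<in> Obj \<C> \<and> (\<forall>i \<in> I. p i \<in> Hom \<C> P (X i)) \<and>
     (\<forall>T \<in> Obj \<C>. \<forall>t. (\<forall>i \<in> I. t i \<in> Hom \<C> T (X i)) \<longrightarrow>
        (\<exists>!h. h \<in> Hom \<C> T P \<and> (\<forall>i \<in> I. Comp \<C> T P (X i) (p i) h = t i)))"

text \<open>Every finite index set is in bijection with one of natural numbers; \<open>I = {}\<close> is the case of
  terminal objects.\<close>

definition preserves_finite_products ::
  "('o, 'a) cat \<Rightarrow> ('p, 'b) cat \<Rightarrow> ('o, 'a, 'p, 'b) functor_data \<Rightarrow> bool" where
  "preserves_finite_products \<C> \<D> F \<longleftrightarrow>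
     (\<forall>(I :: nat set) X P p. finite I \<longrightarrow> is_product \<C> I X P p \<longrightarrow>
        is_product \<D> I (\<lambda>i. FOb F (X i)) (FOb F P) (\<lambda>i. FAr F P (X i) (p i)))"

section \<open>Monoid homomorphisms, kernels and cokernels\<close>

text \<open>The library's \<open>hom\<close> does not demand preservation of the unit.  Homomorphisms are taken
  extensional, so that equality of functions is equality on the carrier.\<close>

definition mhom :: "('a, 'r) monoid_scheme \<Rightarrow> ('b, 's) monoid_scheme \<Rightarrow> ('a \<Rightarrow> 'b) set" where
  "mhom G H = {f \<in> hom G H \<inter> extensional (carrier G). f \<one>\<^bsub>G\<^esub> = \<one>\<^bsub>H\<^esub>}"

definition End_monoid :: "('a, 'r) monoid_scheme \<Rightarrow> ('a \<Rightarrow> 'a) monoid" where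
  "End_monoid B = \<lparr>carrier = mhom B B, mult = compose (carrier B), one = (\<lambda>x \<in> carrier B. x)\<rparr>"

definition right_cancellative :: "('a, 'r) monoid_scheme \<Rightarrow> bool" where
  "right_cancellative G \<longleftrightarrow>
     (\<forall>a \<in> carrier G. \<forall>b \<in> carrier G. \<forall>c \<in> carrier G. a \<otimes>\<^bsub>G\<^esub> c = b \<otimes>\<^bsub>G\<^esub> c \<longrightarrow> a = b)"

definition null_composite ::
  "('a, 'r) monoid_scheme \<Rightarrow> ('c, 's) monoid_scheme \<Rightarrow> ('a \<Rightarrow> 'b) \<Rightarrow> ('b \<Rightarrow> 'c) \<Rightarrow> bool" where
  "null_composite K Y k f \<longleftrightarrow> (\<forall>a \<in> carrier K. f (k a) = \<one>\<^bsub>Y\<^esub>)"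

definition is_kernel ::
  "'u monoid \<Rightarrow> 'u monoid \<Rightarrow> 'u monoid \<Rightarrow> ('u \<Rightarrow> 'u) \<Rightarrow> ('u \<Rightarrow> 'u) \<Rightarrow> bool" where
  "is_kernel K X Y k f \<longleftrightarrow>
     k \<in> mhom K X \<and> f \<in> mhom X Y \<and> null_composite K Y k f \<and>
     (\<forall>T :: 'u monoid. monoid T \<longrightarrow> (\<forall>t \<in> mhom T X. null_composite T Y t f \<longrightarrow>
        (\<exists>!s. s \<in> mhom T K \<and> compose (carrier T) k s = t)))"

definition is_cokernel ::
  "'u monoid \<Rightarrow> 'u monoid \<Rightarrow> 'u monoid \<Rightarrow> ('u \<Rightarrow> 'u) \<Rightarrow> ('u \<Rightarrow> 'u) \<Rightarrow> bool" where
  "is_cokernel K X Y k f \<longleftrightarrow>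
     k \<in> mhom K X \<and> f \<in> mhom X Y \<and> null_composite K Y k f \<and>
     (\<forall>T :: 'u monoid. monoid T \<longrightarrow> (\<forall>t \<in> mhom X T. null_composite K T k t \<longrightarrow>
        (\<exists>!s. s \<in> mhom Y T \<and> compose (carrier X) s f = t)))"

section \<open>Schreier extensions\<close>

text \<open>\<open>u\<close> is a representative (of \<open>f u\<close>).  Being a representative is a property of elements of
  \<open>X\<close>; no choice of representatives is part of the data of an extension.\<close>

definition representative ::
  "'u monoid \<Rightarrow> 'u monoid \<Rightarrow> ('u \<Rightarrow> 'u) \<Rightarrow> ('u \<Rightarrow> 'u) \<Rightarrow> 'u \<Rightarrow> bool" where
  "representative K X k f u \<longleftrightarrow>
     u \<in> carrier X \<and>
     (\<forall>x \<in> carrier X. f x = f u \<longrightarrow> (\<exists>!a. a \<in> carrier K \<and> x = k a \<otimes>\<^bsub>X\<^esub> u))"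

definition schreier_extension ::
  "'u monoid \<Rightarrow> 'u monoid \<Rightarrow> 'u monoid \<Rightarrow> ('u \<Rightarrow> 'u) \<Rightarrow> ('u \<Rightarrow> 'u) \<Rightarrow> bool" where
  "schreier_extension K X M k f \<longleftrightarrow>
     monoid K \<and> monoid X \<and> monoid M \<and>
     is_kernel K X M k f \<and> is_cokernel K X M k f \<and>
     (\<forall>m \<in> carrier M. \<exists>u. representative K X k f u \<and> f u = m)"

definition schreier_morphism ::
  "'u monoid \<Rightarrow> 'u monoid \<Rightarrow> 'u monoid \<Rightarrow> ('u \<Rightarrow> 'u) \<Rightarrow> ('u \<Rightarrow> 'u) \<Rightarrow>
   'u monoid \<Rightarrow> 'u monoid \<Rightarrow> 'u monoid \<Rightarrow> ('u \<Rightarrow> 'u) \<Rightarrow> ('u \<Rightarrow> 'u) \<Rightarrow>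
   ('u \<Rightarrow> 'u) \<Rightarrow> ('u \<Rightarrow> 'u) \<Rightarrow> ('u \<Rightarrow> 'u) \<Rightarrow> bool" where
  "schreier_morphism K X M k f K' X' M' k' f' g\<^sub>1 g\<^sub>2 g\<^sub>3 \<longleftrightarrow>
     g\<^sub>1 \<in> mhom K K' \<and> g\<^sub>2 \<in> mhom X X' \<and> g\<^sub>3 \<in> mhom M M' \<and>
     (\<forall>a \<in> carrier K. g\<^sub>2 (k a) = k' (g\<^sub>1 a)) \<and>
     (\<forall>x \<in> carrier X. g\<^sub>3 (f x) = f' (g\<^sub>2 x)) \<and>
     (\<forall>u. representative K X k f u \<longrightarrow> representative K' X' k' f' (g\<^sub>2 u))"

section \<open>Crossed semimodules\<close>

definition crossed_semimodule ::
  "'u monoid \<Rightarrow> 'u monoid \<Rightarrow> ('u \<Rightarrow> 'u) \<Rightarrow> ('u \<Rightarrow> 'u \<Rightarrow> 'u) \<Rightarrow> bool" where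
  "crossed_semimodule B C \<delta> \<alpha> \<longleftrightarrow>
     monoid B \<and> monoid C \<and> \<delta> \<in> mhom B C \<and> \<alpha> \<in> mhom C (End_monoid B) \<and>
     (\<forall>c \<in> carrier C. \<forall>b \<in> carrier B. \<delta> (\<alpha> c b) \<otimes>\<^bsub>C\<^esub> c = c \<otimes>\<^bsub>C\<^esub> \<delta> b) \<and>
     (\<forall>b\<^sub>1 \<in> carrier B. \<forall>b\<^sub>2 \<in> carrier B. \<alpha> (\<delta> b\<^sub>1) b\<^sub>2 \<otimes>\<^bsub>B\<^esub> b\<^sub>1 = b\<^sub>1 \<otimes>\<^bsub>B\<^esub> b\<^sub>2)"

definition crossed_semimodule_morphism ::
  "'u monoid \<Rightarrow> 'u monoid \<Rightarrow> ('u \<Rightarrow> 'u) \<Rightarrow> ('u \<Rightarrow> 'u \<Rightarrow> 'u) \<Rightarrow>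
   'u monoid \<Rightarrow> 'u monoid \<Rightarrow> ('u \<Rightarrow> 'u) \<Rightarrow> ('u \<Rightarrow> 'u \<Rightarrow> 'u) \<Rightarrow>
   ('u \<Rightarrow> 'u) \<Rightarrow> ('u \<Rightarrow> 'u) \<Rightarrow> bool" where
  "crossed_semimodule_morphism B C \<delta> \<alpha> B' C' \<delta>' \<alpha>' \<phi> \<psi> \<longleftrightarrow>
     \<phi> \<in> mhom B B' \<and> \<psi> \<in> mhom C C' \<and>
     (\<forall>b \<in> carrier B. \<delta>' (\<phi> b) = \<psi> (\<delta> b)) \<and>
     (\<forall>c \<in> carrier C. \<forall>b \<in> carrier B. \<phi> (\<alpha> c b) = \<alpha>' (\<psi> c) (\<phi> b))"

section \<open>The category of crossed Schreier extensions ending in a monoid\<close>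

text \<open>The data of a sequence \<open>A \<rightarrow> B \<rightarrow> C \<rightarrow> M\<close> with maps \<open>ker\<close>, \<open>bd\<close>, \<open>prj\<close> (the \<open>k\<close>, \<open>\<delta>\<close>, \<open>\<pi>\<close> of
  the mathematics) and the action \<open>act\<close> of \<open>C\<close> on \<open>B\<close>; the end point \<open>M\<close> is a parameter below.\<close>

record 'u xseq =
  MA :: "'u monoid"
  MB :: "'u monoid"
  MC :: "'u monoid"
  ker :: "'u \<Rightarrow> 'u"
  bd :: "'u \<Rightarrow> 'u"
  prj :: "'u \<Rightarrow> 'u"
  act :: "'u \<Rightarrow> 'u \<Rightarrow> 'u"

text \<open>The (regular epimorphism, monomorphism) factorisation of \<open>bd E\<close> is taken through its image
  \<open>MN E\<close>: the first factor is \<open>bd E\<close> itself, the second the inclusion \<open>incl E\<close>.\<close>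

definition MN :: "'u xseq \<Rightarrow> 'u monoid" where
  "MN E = (MC E)\<lparr>carrier := bd E ` carrier (MB E)\<rparr>"

definition incl :: "'u xseq \<Rightarrow> 'u \<Rightarrow> 'u" where
  "incl E = (\<lambda>n \<in> carrier (MN E). n)"

definition crossed_schreier_extension :: "'u monoid \<Rightarrow> 'u xseq \<Rightarrow> bool" where
  "crossed_schreier_extension M E \<longleftrightarrow>
     monoid (MA E) \<and> monoid M \<and>
     crossed_semimodule (MB E) (MC E) (bd E) (act E) \<and>
     is_kernel (MA E) (MB E) (MC E) (ker E) (bd E) \<and>
     is_cokernel (MB E) (MC E) M (bd E) (prj E) \<and>
     right_cancellative (MN E) \<and> schreier_extension (MN E) (MC E) M (incl E) (prj E) \<and>
     right_cancellative (MA E) \<and> schreier_extension (MA E) (MB E) (MN E) (ker E) (bd E)"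

definition star_A :: "'u xseq \<Rightarrow> 'u xseq \<Rightarrow> ('u \<Rightarrow> 'u) \<Rightarrow> 'u \<Rightarrow> 'u" where
  "star_A E E' \<phi> = (\<lambda>a \<in> carrier (MA E). THE a'. a' \<in> carrier (MA E') \<and> ker E' a' = \<phi> (ker E a))"

definition star_N :: "'u xseq \<Rightarrow> ('u \<Rightarrow> 'u) \<Rightarrow> 'u \<Rightarrow> 'u" where
  "star_N E \<psi> = restrict \<psi> (carrier (MN E))"

definition xsext_morphism ::
  "'u monoid \<Rightarrow> 'u xseq \<Rightarrow> 'u xseq \<Rightarrow> ('u \<Rightarrow> 'u) \<Rightarrow> ('u \<Rightarrow> 'u) \<Rightarrow> bool" where
  "xsext_morphism M E E' \<phi> \<psi> \<longleftrightarrow>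
     crossed_semimodule_morphism (MB E) (MC E) (bd E) (act E)
       (MB E') (MC E') (bd E') (act E') \<phi> \<psi> \<and>
     (\<forall>c \<in> carrier (MC E). prj E' (\<psi> c) = prj E c) \<and>
     schreier_morphism (MA E) (MB E) (MN E) (ker E) (bd E)
       (MA E') (MB E') (MN E') (ker E') (bd E') (star_A E E' \<phi>) \<phi> (star_N E \<psi>) \<and>
     schreier_morphism (MN E) (MC E) M (incl E) (prj E)
       (MN E') (MC E') M (incl E') (prj E') (star_N E \<psi>) \<psi> (\<lambda>m \<in> carrier M. m)"

definition XSExt :: "'u monoid \<Rightarrow> ('u xseq, ('u \<Rightarrow> 'u) \<times> ('u \<Rightarrow> 'u)) cat" where
  "XSExt M =
     \<lparr>Obj = {E. crossed_schreier_extension M E},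
      Hom = (\<lambda>E E'. {(\<phi>, \<psi>). xsext_morphism M E E' \<phi> \<psi>}),
      Ident = (\<lambda>E. (\<lambda>b \<in> carrier (MB E). b, \<lambda>c \<in> carrier (MC E). c)),
      Comp = (\<lambda>E E' E'' g f.
        (compose (carrier (MB E)) (fst g) (fst f), compose (carrier (MC E)) (snd g) (snd f)))\<rparr>"

definition com_XSExt :: "'u monoid \<Rightarrow> ('u xseq, ('u \<Rightarrow> 'u) \<times> ('u \<Rightarrow> 'u)) cat" where
  "com_XSExt M = full_subcat (XSExt M) (\<lambda>E. comm_monoid (MB E))"

section \<open>Cancellative semimodules and the functor\<close>

definition can_Smod :: "'u monoid \<Rightarrow> ('u monoid \<times> ('u \<Rightarrow> 'u \<Rightarrow> 'u), 'u \<Rightarrow> 'u) cat" where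
  "can_Smod M =
     \<lparr>Obj = {(A, \<beta>). comm_monoid_cancel A \<and> \<beta> \<in> mhom M (End_monoid A)},
      Hom = (\<lambda>(A, \<beta>) (A', \<beta>'). {h \<in> mhom A A'.
        \<forall>m \<in> carrier M. \<forall>a \<in> carrier A. h (\<beta> m a) = \<beta>' m (h a)}),
      Ident = (\<lambda>(A, \<beta>). \<lambda>a \<in> carrier A. a),
      Comp = (\<lambda>(A, \<beta>) Y Z g f. compose (carrier A) g f)\<rparr>"

text \<open>\<open>\<beta>(m)(a) = \<alpha>(c)(a)\<close> for any \<open>c\<close> over \<open>m\<close>, where \<open>A\<close> is identified with its image under
  the kernel map.\<close>

definition induced_action :: "'u monoid \<Rightarrow> 'u xseq \<Rightarrow> 'u \<Rightarrow> 'u \<Rightarrow> 'u" where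
  "induced_action M E = (\<lambda>m \<in> carrier M. \<lambda>a \<in> carrier (MA E).
     THE a'. a' \<in> carrier (MA E) \<and>
       (\<exists>c \<in> carrier (MC E). prj E c = m \<and> ker E a' = act E c (ker E a)))"

definition D1 :: "'u monoid \<Rightarrow>
    ('u xseq, ('u \<Rightarrow> 'u) \<times> ('u \<Rightarrow> 'u), 'u monoid \<times> ('u \<Rightarrow> 'u \<Rightarrow> 'u), 'u \<Rightarrow> 'u) functor_data" where
  "D1 M = \<lparr>FOb = (\<lambda>E. (MA E, induced_action M E)), FAr = (\<lambda>E E' (\<phi>, \<psi>). star_A E E' \<phi>)\<rparr>"

end

theory Submission
  imports Defs
begin

text \<open>
  Products in \<open>XSExt M\<close> are not computed.  Let \<open>P\<close> be a product of the \<open>X i\<close>, with projections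
  \<open>p i = (\<phi> i, \<psi> i)\<close>, and let \<open>(T, \<beta>)\<close> be a cancellative semimodule.  From \<open>A \<rightarrow> B \<rightarrow> C \<rightarrow> M\<close>,
  the extension \<open>P\<close>, form \<open>W = (T \<times> A \<rightarrow> T \<times> B \<rightarrow> C \<rightarrow> M)\<close>.  Kernels are central, so for a morphism
  \<open>(\<phi>, \<psi>) : P \<rightarrow> E\<close> every morphism \<open>g : T \<rightarrow> D1 E\<close> extends to a morphism \<open>W \<rightarrow> E\<close>, namely
  \<open>((t, b) \<mapsto> k (g t) + \<phi> b, \<psi>)\<close>.  A cone \<open>t i : T \<rightarrow> D1 (X i)\<close> thus becomes a cone over the \<open>X i\<close> with
  vertex \<open>W\<close>, and the induced \<open>W \<rightarrow> P\<close>, restricted to \<open>T\<close>, is the required factorisation.  Another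
  factorisation extends, along the identity of \<open>P\<close>, to a morphism \<open>W \<rightarrow> P\<close> over the same cone, so it
  agrees with the first.  Since \<open>T \<times> B\<close> is commutative if \<open>B\<close> is, this covers \<open>com_XSExt M\<close> too.
\<close>

section \<open>Monoid homomorphisms, kernels and Schreier extensions\<close>

lemma mhomI:
  assumes "\<And>x. x \<in> carrier G \<Longrightarrow> f x \<in> carrier H"
    and "\<And>x y. x \<in> carrier G \<Longrightarrow> y \<in> carrier G \<Longrightarrow> f (x \<otimes>\<^bsub>G\<^esub> y) = f x \<otimes>\<^bsub>H\<^esub> f y"
    and "f \<one>\<^bsub>G\<^esub> = \<one>\<^bsub>H\<^esub>" and "f \<in> extensional (carrier G)"
  shows "f \<in> mhom G H"
  using assms unfolding mhom_def hom_def by auto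

lemma mhom_closed: "f \<in> mhom G H \<Longrightarrow> x \<in> carrier G \<Longrightarrow> f x \<in> carrier H"
  unfolding mhom_def hom_def by auto

lemma mhom_mult:
  "f \<in> mhom G H \<Longrightarrow> x \<in> carrier G \<Longrightarrow> y \<in> carrier G \<Longrightarrow> f (x \<otimes>\<^bsub>G\<^esub> y) = f x \<otimes>\<^bsub>H\<^esub> f y"
  unfolding mhom_def hom_def by auto

lemma mhom_one: "f \<in> mhom G H \<Longrightarrow> f \<one>\<^bsub>G\<^esub> = \<one>\<^bsub>H\<^esub>"
  unfolding mhom_def by auto

lemma mhom_extensional: "f \<in> mhom G H \<Longrightarrow> f \<in> extensional (carrier G)"
  unfolding mhom_def by auto

lemma mhom_eqI:
  assumes "f \<in> mhom G H" "g \<in> mhom G H'" "\<And>x. x \<in> carrier G \<Longrightarrow> f x = g x"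
  shows "f = g"
  using assms by (blast intro: extensionalityI mhom_extensional)

lemma mhom_restrict_id: "monoid G \<Longrightarrow> (\<lambda>x \<in> carrier G. x) \<in> mhom G G"
  by (rule mhomI) (auto simp: monoid.m_closed monoid.one_closed)

lemma mhom_compose:
  assumes "monoid G" "f \<in> mhom G H" "g \<in> mhom H K"
  shows "compose (carrier G) g f \<in> mhom G K"
  using assms
  by (intro mhomI)
     (auto simp: compose_def mhom_closed mhom_mult mhom_one monoid.m_closed monoid.one_closed)

text \<open>The universal property quantifies only over monoids with carrier in \<open>'u\<close>.
  The submonoid of elements sent to the unit is such a monoid, so its inclusion may be tested and
  factors through \<open>k\<close>. Conversely, injectivity lets every test map be pulled back
  pointwise along \<open>k\<close>.\<close>

lemma is_kernel_iff:
  fixes K X Y :: "'u monoid"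
  assumes K: "monoid K" and X: "monoid X" and Y: "monoid Y"
  shows "is_kernel K X Y k f \<longleftrightarrow>
    k \<in> mhom K X \<and> f \<in> mhom X Y \<and> inj_on k (carrier K) \<and>
    k ` carrier K = {x \<in> carrier X. f x = \<one>\<^bsub>Y\<^esub>}"
proof
  assume ker: "is_kernel K X Y k f"
  then have k: "k \<in> mhom K X" and f: "f \<in> mhom X Y" and null: "null_composite K Y k f"
    and univ: "\<And>(T :: 'u monoid) t. monoid T \<Longrightarrow> t \<in> mhom T X \<Longrightarrow> null_composite T Y t f \<Longrightarrow>
        \<exists>!s. s \<in> mhom T K \<and> compose (carrier T) k s = t"
    unfolding is_kernel_def by blast+
  define T where "T = X\<lparr>carrier := {x \<in> carrier X. f x = \<one>\<^bsub>Y\<^esub>}\<rparr>"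
  have T: "monoid T"
    using X Y f unfolding T_def
    by (intro monoidI) (auto simp: mhom_mult mhom_one monoid.m_closed monoid.one_closed
        monoid.m_assoc monoid.l_one monoid.r_one)
  have i: "(\<lambda>x \<in> carrier T. x) \<in> mhom T X"
    using mhom_restrict_id[OF T] unfolding mhom_def hom_def T_def by auto
  have "null_composite T Y (\<lambda>x \<in> carrier T. x) f"
    unfolding null_composite_def T_def by auto
  from univ[OF T i this] obtain s where s: "s \<in> mhom T K"
    and ks: "compose (carrier T) k s = (\<lambda>x \<in> carrier T. x)" by blast
  have ks': "k (s x) = x" if "x \<in> carrier T" for x
    using fun_cong[OF ks, of x] that by (simp add: compose_def)
  have kT: "k \<in> mhom K T"
    using k null unfolding null_composite_def T_def
    by (intro mhomI) (auto simp: mhom_closed mhom_mult mhom_one mhom_extensional)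
  have sk: "compose (carrier K) s k \<in> mhom K K"
    using mhom_compose[OF K kT s] .
  \<comment> \<open>Both \<open>s\<close> after \<open>k\<close> and the identity factor
    \<open>k\<close> through itself, so uniqueness identifies them. The resulting left inverse of
    \<open>k\<close> gives injectivity.\<close>
  have "compose (carrier K) s k = (\<lambda>x \<in> carrier K. x)"
  proof -
    have "compose (carrier K) k (compose (carrier K) s k) = k"
      by (rule extensionalityI[of _ "carrier K"])
         (auto simp: compose_def ks' mhom_closed[OF kT] mhom_extensional[OF k])
    moreover have "compose (carrier K) k (\<lambda>x \<in> carrier K. x) = k"
      by (rule extensionalityI[of _ "carrier K"])
         (auto simp: compose_def mhom_extensional[OF k])
    ultimately show ?thesis
      using univ[OF K k null] sk mhom_restrict_id[OF K] by blast
  qed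
  then have sk': "s (k a) = a" if "a \<in> carrier K" for a
    using that by (metis compose_eq restrict_apply)
  have "inj_on k (carrier K)"
    by (metis inj_onI sk')
  moreover have "k ` carrier K = carrier T"
    using ks' mhom_closed[OF kT] mhom_closed[OF s] by (auto intro!: image_eqI)
  ultimately show "k \<in> mhom K X \<and> f \<in> mhom X Y \<and> inj_on k (carrier K) \<and>
    k ` carrier K = {x \<in> carrier X. f x = \<one>\<^bsub>Y\<^esub>}"
    using k f by (simp add: T_def)
next
  assume "k \<in> mhom K X \<and> f \<in> mhom X Y \<and> inj_on k (carrier K) \<and>
    k ` carrier K = {x \<in> carrier X. f x = \<one>\<^bsub>Y\<^esub>}"
  then have k: "k \<in> mhom K X" and f: "f \<in> mhom X Y" and inj: "inj_on k (carrier K)"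
    and im: "k ` carrier K = {x \<in> carrier X. f x = \<one>\<^bsub>Y\<^esub>}" by auto
  have "\<exists>!s. s \<in> mhom T K \<and> compose (carrier T) k s = t"
    if T: "monoid T" and t: "t \<in> mhom T X" and null: "null_composite T Y t f" for T :: "'u monoid" and t
  proof
    define s where "s = (\<lambda>x \<in> carrier T. inv_into (carrier K) k (t x))"
    have tk: "t x \<in> k ` carrier K" if "x \<in> carrier T" for x
      using that null mhom_closed[OF t] unfolding im null_composite_def by auto
    have s_closed: "s x \<in> carrier K" and ks: "k (s x) = t x" if "x \<in> carrier T" for x
      using tk[OF that] that by (auto simp: s_def inv_into_into f_inv_into_f)
    have "s \<in> mhom T K"
    proof (rule mhomI)
      fix x y assume xy: "x \<in> carrier T" "y \<in> carrier T"
      have "k (s (x \<otimes>\<^bsub>T\<^esub> y)) = k (s x \<otimes>\<^bsub>K\<^esub> s y)"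
        using xy by (simp add: ks mhom_mult[OF k] mhom_mult[OF t] s_closed monoid.m_closed[OF T])
      then show "s (x \<otimes>\<^bsub>T\<^esub> y) = s x \<otimes>\<^bsub>K\<^esub> s y"
        using xy inj by (meson K T inj_onD monoid.m_closed s_closed)
    next
      have "k (s \<one>\<^bsub>T\<^esub>) = k \<one>\<^bsub>K\<^esub>"
        by (simp add: ks mhom_one[OF k] mhom_one[OF t] monoid.one_closed[OF T])
      then show "s \<one>\<^bsub>T\<^esub> = \<one>\<^bsub>K\<^esub>"
        using inj by (meson K T inj_onD monoid.one_closed s_closed)
    qed (auto simp: s_closed, simp add: s_def)
    moreover have "compose (carrier T) k s = t"
      by (rule extensionalityI[of _ "carrier T"]) (auto simp: compose_def ks mhom_extensional[OF t])
    ultimately show "s \<in> mhom T K \<and> compose (carrier T) k s = t" by simp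
    fix s' assume s': "s' \<in> mhom T K \<and> compose (carrier T) k s' = t"
    show "s' = s"
    proof (rule mhom_eqI)
      show "s' \<in> mhom T K" "s \<in> mhom T K" using s' \<open>s \<in> mhom T K\<close> by auto
      fix x assume x: "x \<in> carrier T"
      have "k (s' x) = k (s x)"
        using s' x by (metis compose_eq ks)
      then show "s' x = s x"
        using inj x s' by (meson inj_onD mhom_closed s_closed)
    qed
  qed
  moreover have "null_composite K Y k f"
    unfolding null_composite_def using im by blast
  ultimately show "is_kernel K X Y k f"
    unfolding is_kernel_def using k f by blast
qed

text \<open>The map \<open>k\<close> enters the universal property only through the condition that a
  test map kills its image. This transfers the cokernel condition when the first monoid is enlarged
  without changing the image.\<close>

lemma is_cokernel_cong_image:
  assumes "is_cokernel K X Y k f" "k' \<in> mhom K' X" "k' ` carrier K' = k ` carrier K"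
  shows "is_cokernel K' X Y k' f"
proof -
  have "null_composite K' Z k' t \<longleftrightarrow> null_composite K Z k t" for Z :: "'a monoid" and t
    unfolding null_composite_def using assms(3) by (metis (no_types, lifting) image_iff)
  then show ?thesis
    using assms(1,2) unfolding is_cokernel_def by simp
qed

section \<open>Representatives and a criterion for Schreier extensions\<close>

lemma representative_decomp:
  assumes "representative K X k f u" "x \<in> carrier X" "f x = f u"
  obtains a where "a \<in> carrier K" "x = k a \<otimes>\<^bsub>X\<^esub> u"
  using assms unfolding representative_def by blast

lemma representative_unique:
  assumes "representative K X k f u" "a \<in> carrier K" "a' \<in> carrier K"
    and "k a \<otimes>\<^bsub>X\<^esub> u = k a' \<otimes>\<^bsub>X\<^esub> u"
    and "k a \<otimes>\<^bsub>X\<^esub> u \<in> carrier X" "f (k a \<otimes>\<^bsub>X\<^esub> u) = f u"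
  shows "a = a'"
  using assms unfolding representative_def by blast

lemma representative_carrier: "representative K X k f u \<Longrightarrow> u \<in> carrier X"
  unfolding representative_def by blast

text \<open>The cokernel property follows from the representatives: the elements of a fibre of
  \<open>f\<close> have the form \<open>k a \<otimes> u\<close> for one fixed \<open>u\<close>, so a
  homomorphism killing the image of \<open>k\<close> is constant on fibres and descends to
  \<open>Y\<close>.\<close>

lemma schreier_extensionI:
  fixes K X Y :: "'u monoid"
  assumes K: "monoid K" and X: "monoid X" and Y: "monoid Y"
    and k: "k \<in> mhom K X" and f: "f \<in> mhom X Y"
    and inj: "inj_on k (carrier K)"
    and im: "k ` carrier K = {x \<in> carrier X. f x = \<one>\<^bsub>Y\<^esub>}"
    and rep: "\<And>m. m \<in> carrier Y \<Longrightarrow> \<exists>u. representative K X k f u \<and> f u = m"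
  shows "schreier_extension K X Y k f"
proof -
  have null: "null_composite K Y k f"
    unfolding null_composite_def using im by blast
  have surj: "\<exists>x \<in> carrier X. f x = m" if "m \<in> carrier Y" for m
    using rep[OF that] unfolding representative_def by blast
  have "\<exists>!s. s \<in> mhom Y T \<and> compose (carrier X) s f = t"
    if T: "monoid T" and t: "t \<in> mhom X T" and kt: "null_composite K T k t" for T :: "'u monoid" and t
  proof
    have t_cong: "t x = t y" if x: "x \<in> carrier X" and y: "y \<in> carrier X" and "f x = f y" for x y
    proof -
      obtain u where u: "representative K X k f u" "f u = f x"
        using rep mhom_closed[OF f x] by blast
      have *: "t z = t u" if z: "z \<in> carrier X" "f z = f x" for z
      proof -
        obtain a where "a \<in> carrier K" "z = k a \<otimes>\<^bsub>X\<^esub> u"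
          using representative_decomp[OF u(1) z(1)] u(2) z(2) by metis
        moreover have "u \<in> carrier X" using representative_carrier[OF u(1)] .
        ultimately show ?thesis
          using kt unfolding null_composite_def
          by (simp add: mhom_mult[OF t] mhom_closed[OF k] mhom_closed[OF t] monoid.l_one[OF T])
      qed
      show ?thesis using *[of x] *[of y] that by simp
    qed
    \<comment> \<open>An arbitrary section of \<open>f\<close>; by \<open>t_cong\<close> the
      descended map does not depend on it.\<close>
    define r where "r m = (SOME x. x \<in> carrier X \<and> f x = m)" for m
    have r: "r m \<in> carrier X" "f (r m) = m" if "m \<in> carrier Y" for m
      using someI_ex[of "\<lambda>x. x \<in> carrier X \<and> f x = m"] surj[OF that] unfolding r_def by blast+
    define s where "s = (\<lambda>m \<in> carrier Y. t (r m))"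
    have s: "s (f x) = t x" if "x \<in> carrier X" for x
      using that r[OF mhom_closed[OF f that]] by (auto simp: s_def mhom_closed[OF f] intro: t_cong)
    have "s \<in> mhom Y T"
    proof (rule mhomI)
      show "s m \<in> carrier T" if "m \<in> carrier Y" for m
        using that r by (simp add: s_def mhom_closed[OF t])
      show "s (m \<otimes>\<^bsub>Y\<^esub> n) = s m \<otimes>\<^bsub>T\<^esub> s n" if "m \<in> carrier Y" "n \<in> carrier Y" for m n
        using surj[OF that(1)] surj[OF that(2)] monoid.m_closed[OF X]
        by (auto simp: mhom_mult[OF f, symmetric] s mhom_mult[OF t])
      show "s \<one>\<^bsub>Y\<^esub> = \<one>\<^bsub>T\<^esub>"
        using s[OF monoid.one_closed[OF X]] by (simp add: mhom_one[OF f] mhom_one[OF t])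
    qed (simp add: s_def)
    moreover have "compose (carrier X) s f = t"
      by (rule extensionalityI[of _ "carrier X"]) (auto simp: compose_def s mhom_extensional[OF t])
    ultimately show "s \<in> mhom Y T \<and> compose (carrier X) s f = t" by simp
    fix s' assume s': "s' \<in> mhom Y T \<and> compose (carrier X) s' f = t"
    show "s' = s"
    proof (rule mhom_eqI)
      show "s' \<in> mhom Y T" "s \<in> mhom Y T" using s' \<open>s \<in> mhom Y T\<close> by auto
      fix m assume "m \<in> carrier Y"
      then show "s' m = s m"
        using surj s' s by (metis compose_eq)
    qed
  qed
  then have "is_cokernel K X Y k f"
    unfolding is_cokernel_def using k f null by blast
  moreover have "is_kernel K X Y k f"
    using is_kernel_iff[OF K X Y] k f inj im by blast
  ultimately show ?thesis
    unfolding schreier_extension_def using K X Y rep by blast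
qed

section \<open>Crossed Schreier extensions and the induced action\<close>

locale crossed_schreier =
  fixes M :: "'u monoid" and E :: "'u xseq"
  assumes cse: "crossed_schreier_extension M E"
begin

lemma schreier_N: "schreier_extension (MN E) (MC E) M (incl E) (prj E)"
  and schreier_A: "schreier_extension (MA E) (MB E) (MN E) (ker E) (bd E)"
  and cs: "crossed_semimodule (MB E) (MC E) (bd E) (act E)"
  and cancel_N: "right_cancellative (MN E)"
  and cancel_A: "right_cancellative (MA E)"
  and cokernel: "is_cokernel (MB E) (MC E) M (bd E) (prj E)"
  using cse unfolding crossed_schreier_extension_def by auto

lemma monoid_A: "monoid (MA E)" and monoid_B: "monoid (MB E)" and monoid_C: "monoid (MC E)"
  and monoid_N: "monoid (MN E)" and monoid_M: "monoid M"
  using schreier_N schreier_A unfolding schreier_extension_def by auto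

lemma ker_hom: "ker E \<in> mhom (MA E) (MB E)"
  and ker_inj: "inj_on (ker E) (carrier (MA E))"
  and ker_image: "ker E ` carrier (MA E) = {b \<in> carrier (MB E). bd E b = \<one>\<^bsub>MC E\<^esub>}"
  using cse is_kernel_iff[OF monoid_A monoid_B monoid_C]
  unfolding crossed_schreier_extension_def by auto

lemma bd_hom: "bd E \<in> mhom (MB E) (MC E)"
  and act_End: "act E \<in> mhom (MC E) (End_monoid (MB E))"
  and bd_act: "c \<in> carrier (MC E) \<Longrightarrow> b \<in> carrier (MB E) \<Longrightarrow>
    bd E (act E c b) \<otimes>\<^bsub>MC E\<^esub> c = c \<otimes>\<^bsub>MC E\<^esub> bd E b"
  and peiffer: "b \<in> carrier (MB E) \<Longrightarrow> b' \<in> carrier (MB E) \<Longrightarrow>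
    act E (bd E b) b' \<otimes>\<^bsub>MB E\<^esub> b = b \<otimes>\<^bsub>MB E\<^esub> b'"
  using cs unfolding crossed_semimodule_def by auto

lemma prj_hom: "prj E \<in> mhom (MC E) M"
  using cokernel unfolding is_cokernel_def by blast

lemma act_hom: "c \<in> carrier (MC E) \<Longrightarrow> act E c \<in> mhom (MB E) (MB E)"
  using mhom_closed[OF act_End] by (simp add: End_monoid_def)

lemma act_mult:
  "c \<in> carrier (MC E) \<Longrightarrow> d \<in> carrier (MC E) \<Longrightarrow> b \<in> carrier (MB E) \<Longrightarrow>
    act E (c \<otimes>\<^bsub>MC E\<^esub> d) b = act E c (act E d b)"
  using mhom_mult[OF act_End, of c d] by (simp add: End_monoid_def compose_eq)

lemma act_one: "b \<in> carrier (MB E) \<Longrightarrow> act E \<one>\<^bsub>MC E\<^esub> b = b"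
  using mhom_one[OF act_End] by (simp add: End_monoid_def)

lemmas closed [simp] = mhom_closed[OF ker_hom] mhom_closed[OF bd_hom] mhom_closed[OF prj_hom]
  mhom_closed[OF act_hom]
lemmas m_closed [simp] = monoid.m_closed[OF monoid_A] monoid.m_closed[OF monoid_B]
  monoid.m_closed[OF monoid_C] monoid.m_closed[OF monoid_M]
lemmas one_closed [simp] = monoid.one_closed[OF monoid_A] monoid.one_closed[OF monoid_B]
  monoid.one_closed[OF monoid_C] monoid.one_closed[OF monoid_M]
lemmas ones [simp] = mhom_one[OF ker_hom] mhom_one[OF bd_hom] mhom_one[OF prj_hom]
  mhom_one[OF act_hom]

lemma carrier_N: "carrier (MN E) = bd E ` carrier (MB E)"
  and mult_N: "x \<otimes>\<^bsub>MN E\<^esub> y = x \<otimes>\<^bsub>MC E\<^esub> y" and one_N: "\<one>\<^bsub>MN E\<^esub> = \<one>\<^bsub>MC E\<^esub>"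
  by (auto simp: MN_def)

lemma bd_ker [simp]: "a \<in> carrier (MA E) \<Longrightarrow> bd E (ker E a) = \<one>\<^bsub>MC E\<^esub>"
  using ker_image by blast

lemma ker_eq_iff:
  "a \<in> carrier (MA E) \<Longrightarrow> a' \<in> carrier (MA E) \<Longrightarrow> ker E a = ker E a' \<longleftrightarrow> a = a'"
  using ker_inj by (meson inj_onD)

lemma prj_surj:
  assumes "m \<in> carrier M" obtains c where "c \<in> carrier (MC E)" "prj E c = m"
  using schreier_N assms unfolding schreier_extension_def representative_def by metis

text \<open>The Peiffer condition for \<open>ker E a\<close> and \<open>b\<close>: the boundary of
  \<open>ker E a\<close> is the unit, which acts trivially.\<close>

lemma ker_central:
  "a \<in> carrier (MA E) \<Longrightarrow> b \<in> carrier (MB E) \<Longrightarrow>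
    ker E a \<otimes>\<^bsub>MB E\<^esub> b = b \<otimes>\<^bsub>MB E\<^esub> ker E a"
  using peiffer[of "ker E a" b] act_one[of b] by simp

text \<open>Centrality is reflected along the injective \<open>ker E\<close> and gives
  commutativity, which turns right cancellation into two-sided cancellation.\<close>

lemma comm_monoid_cancel_A: "comm_monoid_cancel (MA E)"
proof -
  have comm: "x \<otimes>\<^bsub>MA E\<^esub> y = y \<otimes>\<^bsub>MA E\<^esub> x" if "x \<in> carrier (MA E)" "y \<in> carrier (MA E)" for x y
    using that ker_central[of x "ker E y"]
    by (subst ker_eq_iff[symmetric]) (auto simp: mhom_mult[OF ker_hom])
  have rc: "x = y" if "x \<otimes>\<^bsub>MA E\<^esub> z = y \<otimes>\<^bsub>MA E\<^esub> z"
    "x \<in> carrier (MA E)" "y \<in> carrier (MA E)" "z \<in> carrier (MA E)" for x y z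
    using cancel_A that unfolding right_cancellative_def by blast
  interpret A: comm_monoid "MA E"
    using monoid_A comm by (simp add: monoid.monoid_comm_monoidI)
  show ?thesis
    by unfold_locales (metis comm rc)+
qed

text \<open>Uniqueness of decompositions is postulated only over representatives. Writing
  \<open>b\<close> as a kernel element \<open>ker E d\<close> times a representative reduces the
  equation to one over that representative; cancellation in \<open>MA E\<close> then removes
  \<open>d\<close>.\<close>

lemma ker_mult_cancel:
  assumes a: "a \<in> carrier (MA E)" "a' \<in> carrier (MA E)" and b: "b \<in> carrier (MB E)"
    and eq: "ker E a \<otimes>\<^bsub>MB E\<^esub> b = ker E a' \<otimes>\<^bsub>MB E\<^esub> b"
  shows "a = a'"
proof -
  obtain u where u: "representative (MA E) (MB E) (ker E) (bd E) u" and fu: "bd E u = bd E b"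
    using schreier_A b unfolding schreier_extension_def carrier_N by blast
  have uB: "u \<in> carrier (MB E)" using representative_carrier[OF u] .
  obtain d where d: "d \<in> carrier (MA E)" "b = ker E d \<otimes>\<^bsub>MB E\<^esub> u"
    using representative_decomp[OF u b] fu by metis
  have "ker E (a \<otimes>\<^bsub>MA E\<^esub> d) \<otimes>\<^bsub>MB E\<^esub> u = ker E (a' \<otimes>\<^bsub>MA E\<^esub> d) \<otimes>\<^bsub>MB E\<^esub> u"
    using eq a d uB by (simp add: mhom_mult[OF ker_hom] monoid.m_assoc[OF monoid_B])
  moreover have "bd E (ker E (a \<otimes>\<^bsub>MA E\<^esub> d) \<otimes>\<^bsub>MB E\<^esub> u) = bd E u"
    using a d uB by (simp add: mhom_mult[OF bd_hom] monoid.l_one[OF monoid_C])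
  ultimately have "a \<otimes>\<^bsub>MA E\<^esub> d = a' \<otimes>\<^bsub>MA E\<^esub> d"
    using representative_unique[OF u] uB a d by simp
  then show ?thesis
    using cancel_A a d unfolding right_cancellative_def by blast
qed

text \<open>By \<open>bd_act\<close>, \<open>c\<close> absorbs this element on the left; a representative of the class of \<open>c\<close>
  reduces the claim to cancellation in \<open>MN E\<close>.\<close>

lemma bd_act_ker:
  assumes c: "c \<in> carrier (MC E)" and a: "a \<in> carrier (MA E)"
  shows "bd E (act E c (ker E a)) = \<one>\<^bsub>MC E\<^esub>"
proof -
  define n where "n = bd E (act E c (ker E a))"
  have n: "n \<in> carrier (MN E)" using c a by (simp add: n_def carrier_N)
  have NC: "x \<in> carrier (MC E)" if "x \<in> carrier (MN E)" for x
    using that by (auto simp: carrier_N)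
  obtain u where u: "representative (MN E) (MC E) (incl E) (prj E) u" and fu: "prj E u = prj E c"
    using schreier_N c unfolding schreier_extension_def by (meson closed(3))
  have uC: "u \<in> carrier (MC E)" using representative_carrier[OF u] .
  obtain d where d: "d \<in> carrier (MN E)" "c = d \<otimes>\<^bsub>MC E\<^esub> u"
    using representative_decomp[OF u c] fu by (metis incl_def restrict_apply')
  have nd: "n \<otimes>\<^bsub>MC E\<^esub> d \<in> carrier (MN E)"
    using monoid.m_closed[OF monoid_N n d(1)] by (simp add: mult_N)
  have "n \<otimes>\<^bsub>MC E\<^esub> c = c"
    unfolding n_def using bd_act[of c "ker E a"] c a by (simp add: monoid.r_one[OF monoid_C])
  then have "(n \<otimes>\<^bsub>MC E\<^esub> d) \<otimes>\<^bsub>MC E\<^esub> u = c"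
    using n d uC NC by (simp add: monoid.m_assoc[OF monoid_C])
  then have "n \<otimes>\<^bsub>MC E\<^esub> d = d"
    using representative_unique[OF u nd d(1)] fu c d nd by (simp add: incl_def)
  then have "n \<otimes>\<^bsub>MN E\<^esub> d = \<one>\<^bsub>MN E\<^esub> \<otimes>\<^bsub>MN E\<^esub> d"
    using d by (simp add: mult_N one_N monoid.l_one[OF monoid_C] NC)
  then show ?thesis
    using cancel_N n d monoid.one_closed[OF monoid_N]
    unfolding right_cancellative_def n_def one_N by blast
qed

text \<open>By \<open>bd_act_ker\<close> the translated element is again killed by
  \<open>bd E\<close>, hence comes from \<open>MA E\<close>: the action of \<open>MC E\<close> on
  \<open>MB E\<close> restricts to the kernel.\<close>

lemma act_ker:
  assumes "c \<in> carrier (MC E)" "a \<in> carrier (MA E)"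
  obtains a' where "a' \<in> carrier (MA E)" "ker E a' = act E c (ker E a)"
proof -
  have "act E c (ker E a) \<in> ker E ` carrier (MA E)"
    using assms by (simp add: ker_image bd_act_ker)
  then show ?thesis by (metis that imageE)
qed

text \<open>Peiffer and centrality make the two sides agree after multiplication by
  \<open>b\<close>. Since the left side is already known to be a kernel element,
  \<open>ker_mult_cancel\<close> removes \<open>b\<close>, although \<open>MB E\<close> itself is
  not assumed cancellative.\<close>

lemma act_bd_ker:
  assumes b: "b \<in> carrier (MB E)" and a: "a \<in> carrier (MA E)"
  shows "act E (bd E b) (ker E a) = ker E a"
proof -
  obtain a' where a': "a' \<in> carrier (MA E)" "ker E a' = act E (bd E b) (ker E a)"
    using act_ker[of "bd E b" a] a b by auto
  then have "ker E a' \<otimes>\<^bsub>MB E\<^esub> b = ker E a \<otimes>\<^bsub>MB E\<^esub> b"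
    using peiffer[of b "ker E a"] a b by (simp add: ker_central)
  then show ?thesis
    using ker_mult_cancel a a' b by metis
qed

text \<open>Elements of one fibre of \<open>prj E\<close> are boundaries times a common
  representative, and boundaries act trivially on the kernel. Hence the action on the kernel depends
  only on the image in \<open>M\<close>.\<close>

lemma act_ker_cong:
  assumes c: "c \<in> carrier (MC E)" "c' \<in> carrier (MC E)" and a: "a \<in> carrier (MA E)"
    and eq: "prj E c = prj E c'"
  shows "act E c (ker E a) = act E c' (ker E a)"
proof -
  obtain u where u: "representative (MN E) (MC E) (incl E) (prj E) u" and fu: "prj E u = prj E c"
    using schreier_N c unfolding schreier_extension_def by (meson closed(3))
  have uC: "u \<in> carrier (MC E)" using representative_carrier[OF u] .
  have "act E d (ker E a) = act E u (ker E a)" if d: "d \<in> carrier (MC E)" "prj E d = prj E u" for d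
  proof -
    obtain n where "n \<in> carrier (MN E)" "d = incl E n \<otimes>\<^bsub>MC E\<^esub> u"
      using representative_decomp[OF u d] .
    then have "n \<in> carrier (MN E)" "d = n \<otimes>\<^bsub>MC E\<^esub> u"
      by (auto simp: incl_def)
    then obtain b where b: "b \<in> carrier (MB E)" "d = bd E b \<otimes>\<^bsub>MC E\<^esub> u"
      unfolding carrier_N by blast
    obtain a' where "a' \<in> carrier (MA E)" "ker E a' = act E u (ker E a)"
      using act_ker uC a by blast
    then show ?thesis
      using b uC a act_bd_ker[of b a'] by (simp add: act_mult)
  qed
  then show ?thesis using c eq fu by metis
qed

section \<open>The induced action of M on the kernel\<close>

lemma induced_action:
  assumes c: "c \<in> carrier (MC E)" and a: "a \<in> carrier (MA E)"
  shows induced_action_closed: "induced_action M E (prj E c) a \<in> carrier (MA E)"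
    and ker_induced_action: "ker E (induced_action M E (prj E c) a) = act E c (ker E a)"
proof -
  obtain a' where a': "a' \<in> carrier (MA E)" "ker E a' = act E c (ker E a)"
    using act_ker c a by blast
  have "induced_action M E (prj E c) a = a'"
    unfolding induced_action_def using c a a'
    by (auto intro!: the_equality simp: ker_eq_iff[symmetric] intro: act_ker_cong)
  then show "induced_action M E (prj E c) a \<in> carrier (MA E)"
    "ker E (induced_action M E (prj E c) a) = act E c (ker E a)"
    using a' by auto
qed

lemma induced_action_hom:
  assumes m: "m \<in> carrier M"
  shows "induced_action M E m \<in> mhom (MA E) (MA E)"
proof -
  obtain c where c: "c \<in> carrier (MC E)" "prj E c = m" using prj_surj[OF m] .
  note cl = induced_action_closed[OF c(1), unfolded c(2)]
  note kr = ker_induced_action[OF c(1), unfolded c(2)]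
  show ?thesis
  proof (rule mhomI)
    fix x y assume "x \<in> carrier (MA E)" "y \<in> carrier (MA E)"
    then show "induced_action M E m (x \<otimes>\<^bsub>MA E\<^esub> y)
      = induced_action M E m x \<otimes>\<^bsub>MA E\<^esub> induced_action M E m y"
      using c by (subst ker_eq_iff[symmetric])
        (auto simp: cl kr mhom_mult[OF ker_hom] mhom_mult[OF act_hom])
  next
    show "induced_action M E m \<one>\<^bsub>MA E\<^esub> = \<one>\<^bsub>MA E\<^esub>"
      using c by (subst ker_eq_iff[symmetric]) (auto simp: cl kr)
  qed (use cl m in \<open>simp_all, simp add: induced_action_def\<close>)
qed

text \<open>The product of lifts of \<open>m\<close> and \<open>n\<close> lifts their product, so
  after applying the injective \<open>ker E\<close> the action laws become those of
  \<open>act E\<close>.\<close>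

lemma induced_action_End: "induced_action M E \<in> mhom M (End_monoid (MA E))"
proof (rule mhomI)
  fix m n assume mn: "m \<in> carrier M" "n \<in> carrier M"
  obtain c d where c: "c \<in> carrier (MC E)" "prj E c = m" and d: "d \<in> carrier (MC E)" "prj E d = n"
    using prj_surj mn by metis
  have cd: "prj E (c \<otimes>\<^bsub>MC E\<^esub> d) = m \<otimes>\<^bsub>M\<^esub> n" using c d by (simp add: mhom_mult[OF prj_hom])
  have "induced_action M E (m \<otimes>\<^bsub>M\<^esub> n)
    = compose (carrier (MA E)) (induced_action M E m) (induced_action M E n)"
  proof (rule mhom_eqI)
    fix x assume x: "x \<in> carrier (MA E)"
    have "ker E (induced_action M E (m \<otimes>\<^bsub>M\<^esub> n) x)
      = ker E (induced_action M E m (induced_action M E n x))"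
      using c d x cd[symmetric] by (simp add: act_mult ker_induced_action induced_action_closed flip: c(2) d(2))
    then show "induced_action M E (m \<otimes>\<^bsub>M\<^esub> n) x
      = compose (carrier (MA E)) (induced_action M E m) (induced_action M E n) x"
      using mn x by (simp add: compose_eq ker_eq_iff mhom_closed[OF induced_action_hom])
  qed (use mn in \<open>auto intro: induced_action_hom mhom_compose monoid_A\<close>)
  then show "induced_action M E (m \<otimes>\<^bsub>M\<^esub> n)
    = induced_action M E m \<otimes>\<^bsub>End_monoid (MA E)\<^esub> induced_action M E n"
    by (simp add: End_monoid_def)
next
  have "induced_action M E \<one>\<^bsub>M\<^esub> = (\<lambda>x \<in> carrier (MA E). x)"
  proof (rule mhom_eqI)
    fix x assume x: "x \<in> carrier (MA E)"
    then show "induced_action M E \<one>\<^bsub>M\<^esub> x = (\<lambda>x \<in> carrier (MA E). x) x"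
      using induced_action[of "\<one>\<^bsub>MC E\<^esub>" x] by (simp add: act_one ker_eq_iff)
  qed (auto intro: induced_action_hom mhom_restrict_id monoid_A)
  then show "induced_action M E \<one>\<^bsub>M\<^esub> = \<one>\<^bsub>End_monoid (MA E)\<^esub>"
    by (simp add: End_monoid_def)
qed (auto simp: End_monoid_def induced_action_hom, simp add: induced_action_def)

text \<open>Only existence of decompositions has to be checked; uniqueness holds over every element
  by \<open>ker_mult_cancel\<close>.\<close>

lemma representativeI:
  assumes "u \<in> carrier (MB E)"
    and "\<And>x. x \<in> carrier (MB E) \<Longrightarrow> bd E x = bd E u \<Longrightarrow>
      \<exists>a \<in> carrier (MA E). x = ker E a \<otimes>\<^bsub>MB E\<^esub> u"
  shows "representative (MA E) (MB E) (ker E) (bd E) u"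
  unfolding representative_def using assms ker_mult_cancel by (metis (no_types, opaque_lifting))

text \<open>If \<open>a'\<close> is inverse to \<open>a\<close>, then
  \<open>ker E d \<otimes> u\<close> equals
  \<open>ker E (d \<otimes> a') \<otimes> (ker E a \<otimes> u)\<close>, so decompositions over
  \<open>u\<close> become decompositions over the translate.\<close>

lemma representative_translate:
  assumes u: "representative (MA E) (MB E) (ker E) (bd E) u"
    and a: "a \<in> carrier (MA E)" "a' \<in> carrier (MA E)" "a' \<otimes>\<^bsub>MA E\<^esub> a = \<one>\<^bsub>MA E\<^esub>"
  shows "representative (MA E) (MB E) (ker E) (bd E) (ker E a \<otimes>\<^bsub>MB E\<^esub> u)"
proof (rule representativeI)
  have uB: "u \<in> carrier (MB E)" using representative_carrier[OF u] .
  then show "ker E a \<otimes>\<^bsub>MB E\<^esub> u \<in> carrier (MB E)" using a by simp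
  fix x assume x: "x \<in> carrier (MB E)" "bd E x = bd E (ker E a \<otimes>\<^bsub>MB E\<^esub> u)"
  then have "bd E x = bd E u"
    using a uB by (simp add: mhom_mult[OF bd_hom] monoid.l_one[OF monoid_C])
  then obtain d where d: "d \<in> carrier (MA E)" "x = ker E d \<otimes>\<^bsub>MB E\<^esub> u"
    using representative_decomp[OF u x(1)] by blast
  have "ker E a' \<otimes>\<^bsub>MB E\<^esub> ker E a = \<one>\<^bsub>MB E\<^esub>"
    using a by (simp flip: mhom_mult[OF ker_hom])
  then have "ker E a' \<otimes>\<^bsub>MB E\<^esub> (ker E a \<otimes>\<^bsub>MB E\<^esub> u) = u"
    using a uB by (simp add: monoid.l_one[OF monoid_B] flip: monoid.m_assoc[OF monoid_B])
  then have "x = ker E (d \<otimes>\<^bsub>MA E\<^esub> a') \<otimes>\<^bsub>MB E\<^esub> (ker E a \<otimes>\<^bsub>MB E\<^esub> u)"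
    using a d uB by (simp add: mhom_mult[OF ker_hom] monoid.m_assoc[OF monoid_B])
  then show "\<exists>d \<in> carrier (MA E). x = ker E d \<otimes>\<^bsub>MB E\<^esub> (ker E a \<otimes>\<^bsub>MB E\<^esub> u)"
    using a d by (intro bexI[of _ "d \<otimes>\<^bsub>MA E\<^esub> a'"]) simp_all
qed

end

text \<open>Morphisms of crossed semimodules over \<open>M\<close>, not yet required to preserve representatives.\<close>

locale crossed_schreier_map = src: crossed_schreier M E + tgt: crossed_schreier M E'
  for M :: "'u monoid" and E E' +
  fixes \<phi> \<psi> :: "'u \<Rightarrow> 'u"
  assumes csm: "crossed_semimodule_morphism (MB E) (MC E) (bd E) (act E)
      (MB E') (MC E') (bd E') (act E') \<phi> \<psi>"
    and prj_map: "c \<in> carrier (MC E) \<Longrightarrow> prj E' (\<psi> c) = prj E c"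
begin

lemma phi_hom: "\<phi> \<in> mhom (MB E) (MB E')"
  and psi_hom: "\<psi> \<in> mhom (MC E) (MC E')"
  and bd_map: "b \<in> carrier (MB E) \<Longrightarrow> bd E' (\<phi> b) = \<psi> (bd E b)"
  and act_map: "c \<in> carrier (MC E) \<Longrightarrow> b \<in> carrier (MB E) \<Longrightarrow>
    \<phi> (act E c b) = act E' (\<psi> c) (\<phi> b)"
  using csm unfolding crossed_semimodule_morphism_def by auto

lemmas map_closed [simp] = mhom_closed[OF phi_hom] mhom_closed[OF psi_hom]

text \<open>Compatibility with the boundaries sends kernel elements to kernel elements, and
  \<open>ker E'\<close> is injective, so the description in \<open>star_A\<close> has exactly one
  solution.\<close>

lemma star_A:
  assumes a: "a \<in> carrier (MA E)"
  shows star_A_closed: "star_A E E' \<phi> a \<in> carrier (MA E')"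
    and ker_star_A: "ker E' (star_A E E' \<phi> a) = \<phi> (ker E a)"
proof -
  have "\<phi> (ker E a) \<in> ker E' ` carrier (MA E')"
    using a by (simp add: tgt.ker_image bd_map mhom_one[OF psi_hom])
  then obtain a' where a': "a' \<in> carrier (MA E')" "ker E' a' = \<phi> (ker E a)"
    by (metis imageE)
  then have "star_A E E' \<phi> a = a'"
    using a by (auto simp: star_A_def tgt.ker_eq_iff simp flip: a'(2) intro!: the_equality)
  then show "star_A E E' \<phi> a \<in> carrier (MA E')" "ker E' (star_A E E' \<phi> a) = \<phi> (ker E a)"
    using a' by auto
qed

lemma star_A_eqI:
  "a \<in> carrier (MA E) \<Longrightarrow> a' \<in> carrier (MA E') \<Longrightarrow> ker E' a' = \<phi> (ker E a) \<Longrightarrow>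
    star_A E E' \<phi> a = a'"
  by (metis ker_star_A star_A_closed tgt.ker_eq_iff)

lemma star_A_hom: "star_A E E' \<phi> \<in> mhom (MA E) (MA E')"
proof (rule mhomI)
  show "star_A E E' \<phi> \<one>\<^bsub>MA E\<^esub> = \<one>\<^bsub>MA E'\<^esub>"
    by (rule star_A_eqI) (simp_all add: mhom_one[OF phi_hom])
  show "star_A E E' \<phi> (x \<otimes>\<^bsub>MA E\<^esub> y) = star_A E E' \<phi> x \<otimes>\<^bsub>MA E'\<^esub> star_A E E' \<phi> y"
    if "x \<in> carrier (MA E)" "y \<in> carrier (MA E)" for x y
    using that by (intro star_A_eqI)
      (simp_all add: star_A_closed ker_star_A mhom_mult[OF tgt.ker_hom] mhom_mult[OF src.ker_hom]
        mhom_mult[OF phi_hom])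
qed (simp_all add: star_A_closed, simp add: star_A_def)

text \<open>If \<open>c\<close> lies over \<open>m\<close>, so does \<open>\<psi> c\<close>. The two
  actions of \<open>m\<close> can therefore be computed with \<open>c\<close> and
  \<open>\<psi> c\<close>, where equivariance of \<open>\<phi>\<close> compares them.\<close>

lemma star_A_induced_action:
  assumes m: "m \<in> carrier M" and a: "a \<in> carrier (MA E)"
  shows "star_A E E' \<phi> (induced_action M E m a) = induced_action M E' m (star_A E E' \<phi> a)"
proof -
  obtain c where c: "c \<in> carrier (MC E)" "prj E c = m" using src.prj_surj[OF m] .
  have "prj E' (\<psi> c) = m" using c prj_map by simp
  then have "ker E' (induced_action M E' m (star_A E E' \<phi> a)) = \<phi> (act E c (ker E a))"
    and "induced_action M E' m (star_A E E' \<phi> a) \<in> carrier (MA E')"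
    using tgt.induced_action[of "\<psi> c" "star_A E E' \<phi> a"] a c
    by (simp_all add: star_A_closed ker_star_A act_map)
  moreover have "ker E (induced_action M E m a) = act E c (ker E a)"
    "induced_action M E m a \<in> carrier (MA E)"
    using src.induced_action[OF c(1) a] c by simp_all
  ultimately show ?thesis
    by (intro star_A_eqI) simp_all
qed

lemma star_N_hom: "star_N E \<psi> \<in> mhom (MN E) (MN E')"
proof (rule mhomI)
  fix x assume "x \<in> carrier (MN E)"
  then show "star_N E \<psi> x \<in> carrier (MN E')"
    by (auto simp: star_N_def src.carrier_N tgt.carrier_N simp flip: bd_map)
next
  fix x y assume xy: "x \<in> carrier (MN E)" "y \<in> carrier (MN E)"
  then show "star_N E \<psi> (x \<otimes>\<^bsub>MN E\<^esub> y) = star_N E \<psi> x \<otimes>\<^bsub>MN E'\<^esub> star_N E \<psi> y"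
    using monoid.m_closed[OF src.monoid_N xy] mhom_mult[OF psi_hom, of x y]
    by (auto simp: star_N_def src.mult_N tgt.mult_N src.carrier_N)
next
  show "star_N E \<psi> \<one>\<^bsub>MN E\<^esub> = \<one>\<^bsub>MN E'\<^esub>"
    using monoid.one_closed[OF src.monoid_N]
    by (simp add: star_N_def src.one_N tgt.one_N mhom_one[OF psi_hom])
qed (simp add: star_N_def)

text \<open>The squares of both Schreier morphisms commute for any crossed semimodule morphism over
  \<open>M\<close>; what remains is that the two kinds of representatives are preserved.\<close>

lemma xsext_morphismI:
  assumes rep_A: "\<And>u. representative (MA E) (MB E) (ker E) (bd E) u \<Longrightarrow>
      representative (MA E') (MB E') (ker E') (bd E') (\<phi> u)"
    and rep_N: "\<And>u. representative (MN E) (MC E) (incl E) (prj E) u \<Longrightarrow>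
      representative (MN E') (MC E') (incl E') (prj E') (\<psi> u)"
  shows "xsext_morphism M E E' \<phi> \<psi>"
proof -
  have "bd E b \<in> carrier (MN E)" if "b \<in> carrier (MB E)" for b
    using that by (simp add: src.carrier_N)
  then have "schreier_morphism (MA E) (MB E) (MN E) (ker E) (bd E)
      (MA E') (MB E') (MN E') (ker E') (bd E') (star_A E E' \<phi>) \<phi> (star_N E \<psi>)"
    unfolding schreier_morphism_def
    using star_A_hom phi_hom star_N_hom rep_A by (auto simp: ker_star_A star_N_def bd_map)
  moreover have "incl E' (star_N E \<psi> n) = \<psi> (incl E n)" if "n \<in> carrier (MN E)" for n
    using that mhom_closed[OF star_N_hom that] by (simp add: incl_def star_N_def)
  then have "schreier_morphism (MN E) (MC E) M (incl E) (prj E)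
      (MN E') (MC E') M (incl E') (prj E') (star_N E \<psi>) \<psi> (\<lambda>m \<in> carrier M. m)"
    unfolding schreier_morphism_def
    using psi_hom star_N_hom rep_N mhom_restrict_id[OF src.monoid_M] by (auto simp: prj_map)
  ultimately show ?thesis
    unfolding xsext_morphism_def using csm prj_map by blast
qed

end

locale crossed_schreier_morphism = src: crossed_schreier M E + tgt: crossed_schreier M E'
  for M :: "'u monoid" and E E' +
  fixes \<phi> \<psi> :: "'u \<Rightarrow> 'u"
  assumes xsext_morphism: "xsext_morphism M E E' \<phi> \<psi>"
begin

sublocale crossed_schreier_map M E E' \<phi> \<psi>
  using xsext_morphism unfolding xsext_morphism_def by unfold_locales auto

lemma rep_A: "representative (MA E) (MB E) (ker E) (bd E) u \<Longrightarrow>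
    representative (MA E') (MB E') (ker E') (bd E') (\<phi> u)"
  and rep_N: "representative (MN E) (MC E) (incl E) (prj E) u \<Longrightarrow>
    representative (MN E') (MC E') (incl E') (prj E') (\<psi> u)"
  using xsext_morphism unfolding xsext_morphism_def schreier_morphism_def by auto

end

section \<open>Identities and composites of morphisms\<close>

lemma xsext_morphism_id:
  assumes "crossed_schreier M E"
  shows "xsext_morphism M E E (\<lambda>b \<in> carrier (MB E). b) (\<lambda>c \<in> carrier (MC E). c)"
proof -
  interpret crossed_schreier M E by fact
  interpret crossed_schreier_map M E E "\<lambda>b \<in> carrier (MB E). b" "\<lambda>c \<in> carrier (MC E). c"
    by unfold_locales
      (auto simp: crossed_semimodule_morphism_def mhom_restrict_id monoid_B monoid_C)
  show ?thesis
    by (rule xsext_morphismI) (auto dest: representative_carrier)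
qed

lemma xsext_morphism_compose:
  assumes f: "crossed_schreier_morphism M E E' \<phi> \<psi>"
    and g: "crossed_schreier_morphism M E' E'' \<phi>' \<psi>'"
  shows "xsext_morphism M E E'' (compose (carrier (MB E)) \<phi>' \<phi>) (compose (carrier (MC E)) \<psi>' \<psi>)"
proof -
  interpret f: crossed_schreier_morphism M E E' \<phi> \<psi> by fact
  interpret g: crossed_schreier_morphism M E' E'' \<phi>' \<psi>' by fact
  interpret crossed_schreier_map M E E''
    "compose (carrier (MB E)) \<phi>' \<phi>" "compose (carrier (MC E)) \<psi>' \<psi>"
    using mhom_compose[OF f.src.monoid_B f.phi_hom g.phi_hom]
      mhom_compose[OF f.src.monoid_C f.psi_hom g.psi_hom]
    by unfold_locales
      (auto simp: crossed_semimodule_morphism_def compose_eq f.bd_map g.bd_map f.act_map g.act_map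
        f.prj_map g.prj_map)
  show ?thesis
    by (rule xsext_morphismI)
      (simp_all add: compose_eq representative_carrier f.rep_A g.rep_A f.rep_N g.rep_N)
qed

lemma star_A_compose:
  assumes f: "crossed_schreier_morphism M E E' \<phi> \<psi>"
    and g: "crossed_schreier_morphism M E' E'' \<phi>' \<psi>'"
  shows "star_A E E'' (compose (carrier (MB E)) \<phi>' \<phi>)
    = compose (carrier (MA E)) (star_A E' E'' \<phi>') (star_A E E' \<phi>)"
proof -
  interpret f: crossed_schreier_morphism M E E' \<phi> \<psi> by fact
  interpret g: crossed_schreier_morphism M E' E'' \<phi>' \<psi>' by fact
  interpret crossed_schreier_morphism M E E''
    "compose (carrier (MB E)) \<phi>' \<phi>" "compose (carrier (MC E)) \<psi>' \<psi>"
    by unfold_locales (rule xsext_morphism_compose[OF f g])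
  show ?thesis
  proof (rule extensionalityI[of _ "carrier (MA E)"])
    fix a assume "a \<in> carrier (MA E)"
    then show "star_A E E'' (compose (carrier (MB E)) \<phi>' \<phi>) a
      = compose (carrier (MA E)) (star_A E' E'' \<phi>') (star_A E E' \<phi>) a"
      by (intro star_A_eqI) (simp_all add: compose_eq f.star_A g.star_A)
  qed (simp_all add: star_A_def)
qed

lemma star_A_id:
  assumes "crossed_schreier M E"
  shows "star_A E E (\<lambda>b \<in> carrier (MB E). b) = (\<lambda>a \<in> carrier (MA E). a)"
proof -
  interpret crossed_schreier M E by fact
  interpret crossed_schreier_morphism M E E "\<lambda>b \<in> carrier (MB E). b" "\<lambda>c \<in> carrier (MC E). c"
    by unfold_locales (rule xsext_morphism_id, fact)
  show ?thesis
    by (rule mhom_eqI[OF star_A_hom mhom_restrict_id[OF monoid_A]]) (simp add: star_A_eqI)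
qed

section \<open>The functor\<close>

lemma Obj_XSExt: "E \<in> Obj (XSExt M) \<longleftrightarrow> crossed_schreier M E"
  by (simp add: XSExt_def crossed_schreier_def)

lemma Hom_XSExt: "f \<in> Hom (XSExt M) E E' \<longleftrightarrow> xsext_morphism M E E' (fst f) (snd f)"
  by (auto simp: XSExt_def split: prod.splits)

lemma Hom_XSExt_iff:
  "crossed_schreier M E \<Longrightarrow> crossed_schreier M E' \<Longrightarrow>
    f \<in> Hom (XSExt M) E E' \<longleftrightarrow> crossed_schreier_morphism M E E' (fst f) (snd f)"
  by (simp add: Hom_XSExt crossed_schreier_morphism_def crossed_schreier_morphism_axioms_def)

lemma Comp_XSExt: "Comp (XSExt M) E E' E'' g f =
    (compose (carrier (MB E)) (fst g) (fst f), compose (carrier (MC E)) (snd g) (snd f))"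
  by (simp add: XSExt_def)

lemma Ident_XSExt: "Ident (XSExt M) E = (\<lambda>b \<in> carrier (MB E). b, \<lambda>c \<in> carrier (MC E). c)"
  by (simp add: XSExt_def)

lemma compose_restrict_id: "f \<in> extensional A \<Longrightarrow> compose A f (\<lambda>x \<in> A. x) = f"
  by (rule extensionalityI[of _ A]) (auto simp: compose_eq)

lemma restrict_id_compose: "f \<in> mhom G H \<Longrightarrow> compose (carrier G) (\<lambda>x \<in> carrier H. x) f = f"
  by (rule extensionalityI[of _ "carrier G"]) (auto simp: compose_eq mhom_closed mhom_extensional)

lemma compose_compose:
  "f \<in> mhom G H \<Longrightarrow> compose (carrier G) (compose (carrier H) h g) f
    = compose (carrier G) h (compose (carrier G) g f)"
  by (rule extensionalityI[of _ "carrier G"]) (auto simp: compose_eq mhom_closed)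

lemma is_category_XSExt: "is_category (XSExt M)"
  unfolding is_category_def
proof (intro conjI ballI)
  fix E assume "E \<in> Obj (XSExt M)"
  then show "Ident (XSExt M) E \<in> Hom (XSExt M) E E"
    by (simp add: Obj_XSExt Hom_XSExt Ident_XSExt xsext_morphism_id)
next
  fix E E' E'' f g
  assume "E \<in> Obj (XSExt M)" "E' \<in> Obj (XSExt M)" "E'' \<in> Obj (XSExt M)"
    "f \<in> Hom (XSExt M) E E'" "g \<in> Hom (XSExt M) E' E''"
  then have "xsext_morphism M E E'' (compose (carrier (MB E)) (fst g) (fst f))
      (compose (carrier (MC E)) (snd g) (snd f))"
    by (intro xsext_morphism_compose) (simp_all add: Obj_XSExt Hom_XSExt_iff)
  then show "Comp (XSExt M) E E' E'' g f \<in> Hom (XSExt M) E E''"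
    by (simp add: Hom_XSExt Comp_XSExt)
next
  fix E E' f
  assume "E \<in> Obj (XSExt M)" "E' \<in> Obj (XSExt M)" "f \<in> Hom (XSExt M) E E'"
  then interpret f: crossed_schreier_morphism M E E' "fst f" "snd f"
    by (simp add: Obj_XSExt Hom_XSExt_iff)
  show "Comp (XSExt M) E E E' f (Ident (XSExt M) E) = f"
    "Comp (XSExt M) E E' E' (Ident (XSExt M) E') f = f"
    using mhom_extensional[OF f.phi_hom] mhom_extensional[OF f.psi_hom]
    by (simp_all add: Comp_XSExt Ident_XSExt compose_restrict_id restrict_id_compose[OF f.phi_hom]
        restrict_id_compose[OF f.psi_hom])
next
  fix D E E' E'' f g h
  assume "D \<in> Obj (XSExt M)" "E \<in> Obj (XSExt M)" "f \<in> Hom (XSExt M) D E"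
  then interpret f: crossed_schreier_morphism M D E "fst f" "snd f"
    by (simp add: Obj_XSExt Hom_XSExt_iff)
  show "Comp (XSExt M) D E E'' (Comp (XSExt M) E E' E'' h g) f
    = Comp (XSExt M) D E' E'' h (Comp (XSExt M) D E E' g f)"
    by (simp add: Comp_XSExt compose_compose[OF f.phi_hom] compose_compose[OF f.psi_hom])
qed

section \<open>The category of cancellative semimodules\<close>

lemma Obj_can_Smod:
  "Y \<in> Obj (can_Smod M) \<longleftrightarrow> comm_monoid_cancel (fst Y) \<and> snd Y \<in> mhom M (End_monoid (fst Y))"
  by (auto simp: can_Smod_def split: prod.splits)

lemma Hom_can_Smod:
  "h \<in> Hom (can_Smod M) Y Z \<longleftrightarrow> h \<in> mhom (fst Y) (fst Z) \<and>
    (\<forall>m \<in> carrier M. \<forall>a \<in> carrier (fst Y). h (snd Y m a) = snd Z m (h a))"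
  by (auto simp: can_Smod_def split: prod.splits)

lemma Ident_can_Smod: "Ident (can_Smod M) Y = (\<lambda>a \<in> carrier (fst Y). a)"
  by (auto simp: can_Smod_def split: prod.splits)

lemma Comp_can_Smod: "Comp (can_Smod M) Y Z W g f = compose (carrier (fst Y)) g f"
  by (auto simp: can_Smod_def split: prod.splits)

lemma action_closed:
  "\<beta> \<in> mhom M (End_monoid A) \<Longrightarrow> m \<in> carrier M \<Longrightarrow> \<beta> m \<in> mhom A A"
  using mhom_closed[of \<beta> M "End_monoid A" m] by (simp add: End_monoid_def)

lemma is_category_can_Smod: "is_category (can_Smod M)"
proof -
  have mon: "monoid (fst Y)" if "Y \<in> Obj (can_Smod M)" for Y :: "'a monoid \<times> ('a \<Rightarrow> 'a \<Rightarrow> 'a)"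
    using that by (simp add: Obj_can_Smod comm_monoid_cancel_def monoid_cancel_def)
  have act: "snd Y m a \<in> carrier (fst Y)"
    if "Y \<in> Obj (can_Smod M)" "m \<in> carrier M" "a \<in> carrier (fst Y)" for Y :: "'a monoid \<times> ('a \<Rightarrow> 'a \<Rightarrow> 'a)" and m a
    using that mhom_closed[OF action_closed] by (auto simp: Obj_can_Smod)
  show ?thesis
    unfolding is_category_def
    by (intro conjI ballI allI)
      (auto simp: Hom_can_Smod Ident_can_Smod Comp_can_Smod compose_eq mhom_closed act
        intro: mhom_restrict_id mon mhom_compose compose_restrict_id restrict_id_compose
          compose_compose mhom_extensional)
qed

lemma is_functor_D1: "is_functor (XSExt M) (can_Smod M) (D1 M)"
  unfolding is_functor_def
proof (intro conjI ballI is_category_XSExt is_category_can_Smod)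
  fix E assume "E \<in> Obj (XSExt M)"
  then interpret crossed_schreier M E by (simp add: Obj_XSExt)
  show "FOb (D1 M) E \<in> Obj (can_Smod M)"
    by (simp add: D1_def Obj_can_Smod comm_monoid_cancel_A induced_action_End)
  show "FAr (D1 M) E E (Ident (XSExt M) E) = Ident (can_Smod M) (FOb (D1 M) E)"
    using star_A_id crossed_schreier_axioms by (simp add: D1_def Ident_XSExt Ident_can_Smod)
next
  fix E E' f
  assume "E \<in> Obj (XSExt M)" "E' \<in> Obj (XSExt M)" "f \<in> Hom (XSExt M) E E'"
  then interpret f: crossed_schreier_morphism M E E' "fst f" "snd f"
    by (simp add: Obj_XSExt Hom_XSExt_iff)
  show "FAr (D1 M) E E' f \<in> Hom (can_Smod M) (FOb (D1 M) E) (FOb (D1 M) E')"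
    by (simp add: D1_def Hom_can_Smod f.star_A_hom f.star_A_induced_action case_prod_beta)
next
  fix E E' E'' f g
  assume "E \<in> Obj (XSExt M)" "E' \<in> Obj (XSExt M)" "E'' \<in> Obj (XSExt M)"
    "f \<in> Hom (XSExt M) E E'" "g \<in> Hom (XSExt M) E' E''"
  then have "crossed_schreier_morphism M E E' (fst f) (snd f)"
    "crossed_schreier_morphism M E' E'' (fst g) (snd g)"
    by (simp_all add: Obj_XSExt Hom_XSExt_iff)
  from star_A_compose[OF this]
  show "FAr (D1 M) E E'' (Comp (XSExt M) E E' E'' g f) =
    Comp (can_Smod M) (FOb (D1 M) E) (FOb (D1 M) E') (FOb (D1 M) E'')
      (FAr (D1 M) E' E'' g) (FAr (D1 M) E E' f)"
    by (simp add: D1_def Comp_XSExt Comp_can_Smod case_prod_beta)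
qed

lemma full_subcat_simps [simp]:
  "Obj (full_subcat \<C> Q) = {X \<in> Obj \<C>. Q X}" "Hom (full_subcat \<C> Q) = Hom \<C>"
  "Ident (full_subcat \<C> Q) = Ident \<C>" "Comp (full_subcat \<C> Q) = Comp \<C>"
  by (simp_all add: full_subcat_def)

lemma is_functor_full_subcat: "is_functor \<C> \<D> F \<Longrightarrow> is_functor (full_subcat \<C> Q) \<D> F"
  unfolding is_functor_def is_category_def by simp


section \<open>Adjoining a semimodule to an extension\<close>

text \<open>The product of monoids, transported into the universe \<open>'u\<close> along an injection \<open>e\<close>.\<close>

definition pair_monoid :: "('u \<times> 'u \<Rightarrow> 'u) \<Rightarrow> 'u monoid \<Rightarrow> 'u monoid \<Rightarrow> 'u monoid" where
  "pair_monoid e G H =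
     \<lparr>carrier = e ` (carrier G \<times> carrier H),
      mult = (\<lambda>x y. e (fst (the_inv e x) \<otimes>\<^bsub>G\<^esub> fst (the_inv e y), snd (the_inv e x) \<otimes>\<^bsub>H\<^esub> snd (the_inv e y))),
      one = e (\<one>\<^bsub>G\<^esub>, \<one>\<^bsub>H\<^esub>)\<rparr>"

text \<open>This is \<open>T \<times> A \<rightarrow> T \<times> B \<rightarrow> C \<rightarrow> M\<close> with \<open>C\<close> acting on \<open>T\<close> through \<open>\<beta>\<close>: the product in \<open>XSExt M\<close>
  of \<open>P\<close> and the extension \<open>T \<rightarrow> T \<rightarrow> M \<rightarrow> M\<close> with trivial boundary.\<close>

definition adjoin ::
  "('u \<times> 'u \<Rightarrow> 'u) \<Rightarrow> 'u monoid \<Rightarrow> ('u \<Rightarrow> 'u \<Rightarrow> 'u) \<Rightarrow> 'u xseq \<Rightarrow> 'u xseq" where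
  "adjoin e T \<beta> P =
     \<lparr>MA = pair_monoid e T (MA P), MB = pair_monoid e T (MB P), MC = MC P,
      ker = (\<lambda>x \<in> carrier (pair_monoid e T (MA P)). e (fst (the_inv e x), ker P (snd (the_inv e x)))),
      bd = (\<lambda>x \<in> carrier (pair_monoid e T (MB P)). bd P (snd (the_inv e x))),
      prj = prj P,
      act = (\<lambda>c \<in> carrier (MC P). \<lambda>x \<in> carrier (pair_monoid e T (MB P)).
        e (\<beta> (prj P c) (fst (the_inv e x)), act P c (snd (the_inv e x))))\<rparr>"

text \<open>The component on \<open>MB\<close> of the extended morphism. It serves twice: with
  \<open>\<phi>\<close> coming from a projection, to build a cone, and with \<open>\<phi>\<close>
  the identity of \<open>MB P\<close>, to prove uniqueness.\<close>

definition ext_map ::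
  "('u \<times> 'u \<Rightarrow> 'u) \<Rightarrow> 'u monoid \<Rightarrow> 'u xseq \<Rightarrow> 'u xseq \<Rightarrow> ('u \<Rightarrow> 'u) \<Rightarrow> ('u \<Rightarrow> 'u) \<Rightarrow> 'u \<Rightarrow> 'u" where
  "ext_map e T P E g \<phi> = (\<lambda>x \<in> carrier (pair_monoid e T (MB P)).
     ker E (g (fst (the_inv e x))) \<otimes>\<^bsub>MB E\<^esub> \<phi> (snd (the_inv e x)))"

section \<open>Calculation in the transported product\<close>

lemma carrier_pair_monoid: "carrier (pair_monoid e G H) = e ` (carrier G \<times> carrier H)"
  and one_pair_monoid: "\<one>\<^bsub>pair_monoid e G H\<^esub> = e (\<one>\<^bsub>G\<^esub>, \<one>\<^bsub>H\<^esub>)"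
  by (simp_all add: pair_monoid_def)

lemma mult_pair_monoid:
  "inj e \<Longrightarrow> e (t, b) \<otimes>\<^bsub>pair_monoid e G H\<^esub> e (t', b') = e (t \<otimes>\<^bsub>G\<^esub> t', b \<otimes>\<^bsub>H\<^esub> b')"
  by (simp add: pair_monoid_def the_inv_f_f)

lemma monoid_pair_monoid:
  assumes "inj e" "monoid G" "monoid H"
  shows "monoid (pair_monoid e G H)"
proof -
  interpret G: monoid G by fact
  interpret H: monoid H by fact
  show ?thesis
    by (rule monoidI)
      (auto simp: carrier_pair_monoid one_pair_monoid mult_pair_monoid[OF \<open>inj e\<close>]
        inj_eq[OF \<open>inj e\<close>] G.m_assoc H.m_assoc)
qed

lemma comm_monoid_pair_monoid:
  assumes "inj e" "comm_monoid G" "comm_monoid H"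
  shows "comm_monoid (pair_monoid e G H)"
proof -
  interpret G: comm_monoid G by fact
  interpret H: comm_monoid H by fact
  show ?thesis
    using monoid_pair_monoid[OF \<open>inj e\<close> G.monoid_axioms H.monoid_axioms]
    by (rule monoid.monoid_comm_monoidI)
      (auto simp: carrier_pair_monoid mult_pair_monoid[OF \<open>inj e\<close>] G.m_comm H.m_comm)
qed

lemma adjoin_simps:
  "MA (adjoin e T \<beta> P) = pair_monoid e T (MA P)" "MB (adjoin e T \<beta> P) = pair_monoid e T (MB P)"
  "MC (adjoin e T \<beta> P) = MC P" "prj (adjoin e T \<beta> P) = prj P"
  by (simp_all add: adjoin_def)

section \<open>The adjoined sequence is a crossed Schreier extension\<close>

locale semimodule_adjunct = crossed_schreier M P
  for M :: "'u monoid" and P +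
  fixes e :: "'u \<times> 'u \<Rightarrow> 'u" and T :: "'u monoid" and \<beta> :: "'u \<Rightarrow> 'u \<Rightarrow> 'u"
  assumes inj_e: "inj e"
    and T_cancel: "comm_monoid_cancel T"
    and \<beta>_hom: "\<beta> \<in> mhom M (End_monoid T)"
begin

abbreviation "W \<equiv> adjoin e T \<beta> P"

sublocale T: comm_monoid_cancel T by (rule T_cancel)

lemma beta_hom: "m \<in> carrier M \<Longrightarrow> \<beta> m \<in> mhom T T"
  by (rule action_closed[OF \<beta>_hom])

lemma beta_mult:
  "m \<in> carrier M \<Longrightarrow> n \<in> carrier M \<Longrightarrow> t \<in> carrier T \<Longrightarrow> \<beta> (m \<otimes>\<^bsub>M\<^esub> n) t = \<beta> m (\<beta> n t)"
  using mhom_mult[OF \<beta>_hom, of m n] by (simp add: End_monoid_def compose_eq)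

lemma beta_one: "t \<in> carrier T \<Longrightarrow> \<beta> \<one>\<^bsub>M\<^esub> t = t"
  using mhom_one[OF \<beta>_hom] by (simp add: End_monoid_def)

lemma e_eq [simp]: "e x = e y \<longleftrightarrow> x = y"
  using inj_e by (simp add: inj_eq)

lemma the_inv_e [simp]: "the_inv e (e x) = x"
  using inj_e by (rule the_inv_f_f)

lemmas beta_closed [simp] = mhom_closed[OF beta_hom]

lemmas mult_W [simp] = mult_pair_monoid[OF inj_e]
lemmas one_W [simp] = one_pair_monoid[of e T]

lemma e_in_W [simp]: "e (t, b) \<in> carrier (pair_monoid e T G) \<longleftrightarrow> t \<in> carrier T \<and> b \<in> carrier G"
  by (auto simp: carrier_pair_monoid)

lemma W_cases:
  assumes "x \<in> carrier (pair_monoid e T G)"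
  obtains t b where "x = e (t, b)" "t \<in> carrier T" "b \<in> carrier G"
  using assms by (auto simp: carrier_pair_monoid)

lemma ker_W [simp]: "t \<in> carrier T \<Longrightarrow> a \<in> carrier (MA P) \<Longrightarrow> ker W (e (t, a)) = e (t, ker P a)"
  and bd_W [simp]: "t \<in> carrier T \<Longrightarrow> b \<in> carrier (MB P) \<Longrightarrow> bd W (e (t, b)) = bd P b"
  and act_W [simp]: "c \<in> carrier (MC P) \<Longrightarrow> t \<in> carrier T \<Longrightarrow> b \<in> carrier (MB P) \<Longrightarrow>
    act W c (e (t, b)) = e (\<beta> (prj P c) t, act P c b)"
  by (simp_all add: adjoin_def)

lemma monoid_MA_W: "monoid (MA W)" and monoid_MB_W: "monoid (MB W)"
  using inj_e T.monoid_axioms monoid_A monoid_B by (auto simp: adjoin_simps intro: monoid_pair_monoid)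

text \<open>The boundary ignores the \<open>T\<close>-component, so its image is unchanged. Thus
  \<open>W\<close> and \<open>P\<close> share the whole row from \<open>MN P\<close> through
  \<open>MC P\<close> to \<open>M\<close>, and the conditions on it carry over.\<close>

lemma bd_W_image: "bd W ` carrier (MB W) = bd P ` carrier (MB P)"
proof -
  have "bd P b \<in> bd W ` carrier (MB W)" if "b \<in> carrier (MB P)" for b
    using that by (intro image_eqI[of _ _ "e (\<one>\<^bsub>T\<^esub>, b)"]) (simp_all add: adjoin_simps)
  then show ?thesis
    by (auto simp: adjoin_simps elim!: W_cases)
qed

lemma MN_W: "MN W = MN P" and incl_W: "incl W = incl P"
proof -
  show "MN W = MN P" by (simp only: MN_def bd_W_image) (simp add: adjoin_simps)
  then show "incl W = incl P" by (simp add: incl_def)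
qed

lemma ker_W_hom: "ker W \<in> mhom (MA W) (MB W)"
  by (rule mhomI)
    (auto simp: adjoin_simps mhom_mult[OF ker_hom] elim!: W_cases, simp add: adjoin_def)

lemma bd_W_hom: "bd W \<in> mhom (MB W) (MC W)"
  by (rule mhomI)
    (auto simp: adjoin_simps mhom_mult[OF bd_hom] elim!: W_cases, simp add: adjoin_def)

lemma bd_W_hom_N: "bd W \<in> mhom (MB W) (MN W)"
  using bd_W_hom bd_W_image unfolding mhom_def hom_def MN_def by auto

lemma ker_W_inj: "inj_on (ker W) (carrier (MA W))"
  by (rule inj_onI) (auto simp: adjoin_simps ker_eq_iff elim!: W_cases)

lemma ker_W_image: "ker W ` carrier (MA W) = {x \<in> carrier (MB W). bd W x = \<one>\<^bsub>MC W\<^esub>}"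
proof -
  have "e (t, b) \<in> ker W ` carrier (MA W)"
    if tb: "t \<in> carrier T" "b \<in> carrier (MB P)" "bd P b = \<one>\<^bsub>MC P\<^esub>" for t b
  proof -
    obtain a where "a \<in> carrier (MA P)" "b = ker P a"
      using tb ker_image by blast
    then show ?thesis
      using that by (intro image_eqI[of _ _ "e (t, a)"]) (simp_all add: adjoin_simps)
  qed
  then show ?thesis
    by (auto simp: adjoin_simps elim!: W_cases)
qed

lemma act_W_hom: "c \<in> carrier (MC P) \<Longrightarrow> act W c \<in> mhom (MB W) (MB W)"
  by (rule mhomI)
    (auto simp: adjoin_simps mhom_mult[OF act_hom] mhom_mult[OF beta_hom] mhom_one[OF beta_hom]
      elim!: W_cases, simp add: adjoin_def)

lemma crossed_semimodule_W: "crossed_semimodule (MB W) (MC W) (bd W) (act W)"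
proof -
  have "act W \<in> mhom (MC W) (End_monoid (MB W))"
  proof (rule mhomI)
    fix c d assume "c \<in> carrier (MC W)" "d \<in> carrier (MC W)"
    then have cd: "c \<in> carrier (MC P)" "d \<in> carrier (MC P)" by (simp_all add: adjoin_simps)
    have "act W (c \<otimes>\<^bsub>MC P\<^esub> d) = compose (carrier (MB W)) (act W c) (act W d)"
      using cd
      by (intro mhom_eqI[OF act_W_hom mhom_compose[OF monoid_MB_W act_W_hom act_W_hom]])
        (auto simp: adjoin_simps compose_eq act_mult beta_mult mhom_mult[OF prj_hom] elim!: W_cases)
    then show "act W (c \<otimes>\<^bsub>MC W\<^esub> d) = act W c \<otimes>\<^bsub>End_monoid (MB W)\<^esub> act W d"
      by (simp add: End_monoid_def adjoin_simps)
  next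
    have "act W \<one>\<^bsub>MC P\<^esub> = (\<lambda>x \<in> carrier (MB W). x)"
      by (intro mhom_eqI[OF act_W_hom mhom_restrict_id[OF monoid_MB_W]])
        (auto simp: adjoin_simps act_one beta_one elim!: W_cases)
    then show "act W \<one>\<^bsub>MC W\<^esub> = \<one>\<^bsub>End_monoid (MB W)\<^esub>"
      by (simp add: End_monoid_def adjoin_simps)
  qed (auto simp: End_monoid_def adjoin_simps act_W_hom[unfolded adjoin_simps], simp add: adjoin_def)
  \<comment> \<open>Boundaries lie over the unit of \<open>M\<close>, hence act trivially on
    \<open>T\<close>; in the \<open>T\<close>-component the Peiffer condition becomes commutativity
    of \<open>T\<close>.\<close>
  moreover have "prj P (bd P b) = \<one>\<^bsub>M\<^esub>" if "b \<in> carrier (MB P)" for b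
    using cokernel that unfolding is_cokernel_def null_composite_def by blast
  ultimately show ?thesis
    unfolding crossed_semimodule_def
    using monoid_MB_W monoid_C bd_W_hom bd_act peiffer
    by (auto simp: adjoin_simps beta_one T.m_comm elim!: W_cases)
qed

text \<open>The \<open>T\<close>-component of an element over \<open>bd P b\<close> is absorbed by
  the kernel: for \<open>b' = ker P a \<otimes> b\<close>, the coefficient of
  \<open>e (t, b')\<close> is \<open>e (t, a)\<close>.\<close>

lemma representative_W:
  assumes b: "representative (MA P) (MB P) (ker P) (bd P) b"
  shows "representative (MA W) (MB W) (ker W) (bd W) (e (\<one>\<^bsub>T\<^esub>, b))"
  unfolding representative_def
proof (intro conjI ballI impI)
  note bB = representative_carrier[OF b]
  show "e (\<one>\<^bsub>T\<^esub>, b) \<in> carrier (MB W)" using bB by (simp add: adjoin_simps)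
  fix x assume x: "x \<in> carrier (MB W)" "bd W x = bd W (e (\<one>\<^bsub>T\<^esub>, b))"
  then obtain t b' where tb: "x = e (t, b')" "t \<in> carrier T" "b' \<in> carrier (MB P)"
    by (auto simp: adjoin_simps elim!: W_cases)
  then have "bd P b' = bd P b" using x bB by simp
  then obtain a where a: "a \<in> carrier (MA P)" "b' = ker P a \<otimes>\<^bsub>MB P\<^esub> b"
    using representative_decomp[OF b tb(3)] by blast
  show "\<exists>!a. a \<in> carrier (MA W) \<and> x = ker W a \<otimes>\<^bsub>MB W\<^esub> e (\<one>\<^bsub>T\<^esub>, b)"
  proof
    show "e (t, a) \<in> carrier (MA W) \<and> x = ker W (e (t, a)) \<otimes>\<^bsub>MB W\<^esub> e (\<one>\<^bsub>T\<^esub>, b)"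
      using tb a bB by (simp add: adjoin_simps)
    show "y = e (t, a)" if y: "y \<in> carrier (MA W) \<and> x = ker W y \<otimes>\<^bsub>MB W\<^esub> e (\<one>\<^bsub>T\<^esub>, b)" for y
      using y tb a bB ker_mult_cancel by (auto simp: adjoin_simps elim!: W_cases)
  qed
qed

text \<open>A representative may have a nontrivial \<open>T\<close>-component, but it is invertible: this is why the
  maps of \<open>ext_map_morphism\<close> preserve representatives.\<close>

lemma representative_WD:
  assumes "representative (MA W) (MB W) (ker W) (bd W) x"
  obtains t t' b where "x = e (t, b)" "t \<in> carrier T" "t' \<in> carrier T" "t' \<otimes>\<^bsub>T\<^esub> t = \<one>\<^bsub>T\<^esub>"
    "representative (MA P) (MB P) (ker P) (bd P) b"
proof -
  obtain t b where tb: "x = e (t, b)" "t \<in> carrier T" "b \<in> carrier (MB P)"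
    using representative_carrier[OF assms] by (auto simp: adjoin_simps elim!: W_cases)
  have *: "\<exists>s \<in> carrier T. \<exists>a \<in> carrier (MA P). t' = s \<otimes>\<^bsub>T\<^esub> t \<and> b' = ker P a \<otimes>\<^bsub>MB P\<^esub> b"
    if tb': "t' \<in> carrier T" "b' \<in> carrier (MB P)" "bd P b' = bd P b" for t' b'
  proof -
    obtain y where "y \<in> carrier (MA W)" "e (t', b') = ker W y \<otimes>\<^bsub>MB W\<^esub> x"
      by (rule representative_decomp[OF assms, of "e (t', b')"]) (use tb tb' in \<open>auto simp: adjoin_simps\<close>)
    then show ?thesis
      using tb by (auto simp: adjoin_simps elim!: W_cases)
  qed
  \<comment> \<open>Decomposing \<open>e (\<one>, b)\<close> over the representative
    \<open>x\<close> exhibits a left inverse of \<open>t\<close>.\<close>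
  obtain t' where "t' \<in> carrier T" "t' \<otimes>\<^bsub>T\<^esub> t = \<one>\<^bsub>T\<^esub>"
    using *[of "\<one>\<^bsub>T\<^esub>" b] tb by auto
  moreover have "representative (MA P) (MB P) (ker P) (bd P) b"
    using tb *[of t] by (intro representativeI) auto
  ultimately show ?thesis using that tb by blast
qed

lemma crossed_schreier_W: "crossed_schreier M W"
proof
  have kerW: "is_kernel (MA W) (MB W) (MC W) (ker W) (bd W)"
    using is_kernel_iff[OF monoid_MA_W monoid_MB_W, of "MC W"] monoid_C
      ker_W_hom bd_W_hom ker_W_inj ker_W_image by (simp add: adjoin_simps)
  have cokerW: "is_cokernel (MB W) (MC W) M (bd W) (prj W)"
    using is_cokernel_cong_image[OF cokernel, of "bd W" "MB W"] bd_W_hom bd_W_image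
    by (simp add: adjoin_simps)
  have cancelW: "right_cancellative (MA W)"
    unfolding right_cancellative_def
    by (auto simp: adjoin_simps elim!: W_cases dest: T.r_cancel
        monoid_cancel.r_cancel[OF comm_monoid_cancel.axioms(1)[OF comm_monoid_cancel_A]])
  have "schreier_extension (MA W) (MB W) (MN W) (ker W) (bd W)"
  proof (rule schreier_extensionI[OF monoid_MA_W monoid_MB_W _ ker_W_hom bd_W_hom_N ker_W_inj])
    show "monoid (MN W)" by (simp add: MN_W monoid_N)
    show "ker W ` carrier (MA W) = {x \<in> carrier (MB W). bd W x = \<one>\<^bsub>MN W\<^esub>}"
      unfolding ker_W_image by (simp add: MN_def)
    fix n assume "n \<in> carrier (MN W)"
    then obtain b where b: "representative (MA P) (MB P) (ker P) (bd P) b" "bd P b = n"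
      using schreier_A unfolding schreier_extension_def MN_W by blast
    then show "\<exists>u. representative (MA W) (MB W) (ker W) (bd W) u \<and> bd W u = n"
      using representative_W representative_carrier[OF b(1)]
      by (intro exI[of _ "e (\<one>\<^bsub>T\<^esub>, b)"]) simp
  qed
  then show "crossed_schreier_extension M W"
    unfolding crossed_schreier_extension_def
    using monoid_MA_W monoid_M crossed_semimodule_W kerW cokerW cancelW cancel_N schreier_N
    by (simp add: MN_W incl_W) (simp add: adjoin_simps)
qed

section \<open>Extending semimodule maps to morphisms out of the adjoined extension\<close>

lemma ext_map_eq:
  "t \<in> carrier T \<Longrightarrow> b \<in> carrier (MB P) \<Longrightarrow>
    ext_map e T P E g \<phi> (e (t, b)) = ker E (g t) \<otimes>\<^bsub>MB E\<^esub> \<phi> b"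
  by (simp add: ext_map_def)

text \<open>Centrality of the kernel gives additivity, \<open>bd E\<close> kills the added factor,
  and equivariance of \<open>g\<close> gives compatibility with the actions. Representatives survive
  because \<open>g\<close> preserves the invertibility of their \<open>T\<close>-component, so their
  images are translates by invertible kernel elements.\<close>

lemma ext_map_morphism:
  assumes f: "crossed_schreier_morphism M P E \<phi> \<psi>"
    and g: "g \<in> mhom T (MA E)"
    and equiv: "\<And>m t. m \<in> carrier M \<Longrightarrow> t \<in> carrier T \<Longrightarrow> g (\<beta> m t) = induced_action M E m (g t)"
  shows "crossed_schreier_morphism M W E (ext_map e T P E g \<phi>) \<psi>"
proof -
  interpret W: crossed_schreier M W by (rule crossed_schreier_W)
  interpret f: crossed_schreier_morphism M P E \<phi> \<psi> by fact
  note [simp] = mhom_closed[OF g] ext_map_eq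
  have hom: "ext_map e T P E g \<phi> \<in> mhom (MB W) (MB E)"
  proof (rule mhomI)
    fix x y assume "x \<in> carrier (MB W)" "y \<in> carrier (MB W)"
    then obtain t b t' b' where x: "x = e (t, b)" "t \<in> carrier T" "b \<in> carrier (MB P)"
      and y: "y = e (t', b')" "t' \<in> carrier T" "b' \<in> carrier (MB P)"
      by (auto simp: adjoin_simps elim!: W_cases)
    have "ker E (g t) \<otimes>\<^bsub>MB E\<^esub> ker E (g t') \<otimes>\<^bsub>MB E\<^esub> (\<phi> b \<otimes>\<^bsub>MB E\<^esub> \<phi> b')
      = ker E (g t) \<otimes>\<^bsub>MB E\<^esub> ((ker E (g t') \<otimes>\<^bsub>MB E\<^esub> \<phi> b) \<otimes>\<^bsub>MB E\<^esub> \<phi> b')"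
      using x y by (simp add: monoid.m_assoc[OF f.tgt.monoid_B])
    also have "\<dots> = ker E (g t) \<otimes>\<^bsub>MB E\<^esub> \<phi> b \<otimes>\<^bsub>MB E\<^esub> (ker E (g t') \<otimes>\<^bsub>MB E\<^esub> \<phi> b')"
      using x y by (simp add: f.tgt.ker_central[of "g t'" "\<phi> b"] monoid.m_assoc[OF f.tgt.monoid_B])
    finally show "ext_map e T P E g \<phi> (x \<otimes>\<^bsub>MB W\<^esub> y)
      = ext_map e T P E g \<phi> x \<otimes>\<^bsub>MB E\<^esub> ext_map e T P E g \<phi> y"
      using x y by (simp add: adjoin_simps mhom_mult[OF g] mhom_mult[OF f.phi_hom]
          mhom_mult[OF f.tgt.ker_hom])
  qed (auto simp: adjoin_simps mhom_one[OF g] mhom_one[OF f.phi_hom] monoid.l_one[OF f.tgt.monoid_B]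
      elim!: W_cases, simp add: ext_map_def)
  have act: "ext_map e T P E g \<phi> (act W c x) = act E (\<psi> c) (ext_map e T P E g \<phi> x)"
    if "c \<in> carrier (MC W)" "x \<in> carrier (MB W)" for c x
  proof -
    obtain t b where x: "x = e (t, b)" "t \<in> carrier T" "b \<in> carrier (MB P)"
      using \<open>x \<in> carrier (MB W)\<close> by (auto simp: adjoin_simps elim!: W_cases)
    have c: "c \<in> carrier (MC P)" using that by (simp add: adjoin_simps)
    have "ker E (g (\<beta> (prj P c) t)) = act E (\<psi> c) (ker E (g t))"
      using f.tgt.ker_induced_action[of "\<psi> c" "g t"] c x by (simp add: equiv f.prj_map)
    then show ?thesis
      using x c by (simp add: f.act_map mhom_mult[OF f.tgt.act_hom])
  qed
  interpret ext: crossed_schreier_map M W E "ext_map e T P E g \<phi>" \<psi>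
  proof
    have "bd E (ext_map e T P E g \<phi> x) = \<psi> (bd W x)" if "x \<in> carrier (MB W)" for x
      using that by (auto simp: adjoin_simps mhom_mult[OF f.tgt.bd_hom] f.bd_map
          monoid.l_one[OF f.tgt.monoid_C] elim!: W_cases)
    then show "crossed_semimodule_morphism (MB W) (MC W) (bd W) (act W)
        (MB E) (MC E) (bd E) (act E) (ext_map e T P E g \<phi>) \<psi>"
      unfolding crossed_semimodule_morphism_def
      using hom act f.psi_hom by (simp add: adjoin_simps)
  qed (simp add: adjoin_simps f.prj_map)
  show ?thesis
  proof (unfold_locales, rule ext.xsext_morphismI)
    fix u assume "representative (MA W) (MB W) (ker W) (bd W) u"
    then show "representative (MA E) (MB E) (ker E) (bd E) (ext_map e T P E g \<phi> u)"
    proof (rule representative_WD)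
      fix t t' b
      assume "u = e (t, b)" "t \<in> carrier T" "t' \<in> carrier T" "t' \<otimes>\<^bsub>T\<^esub> t = \<one>\<^bsub>T\<^esub>"
        and b: "representative (MA P) (MB P) (ker P) (bd P) b"
      then show ?thesis
        using f.tgt.representative_translate[OF f.rep_A[OF b], of "g t" "g t'"]
          representative_carrier[OF b]
        by (simp add: mhom_one[OF g] flip: mhom_mult[OF g])
    qed
  next
    fix u assume "representative (MN W) (MC W) (incl W) (prj W) u"
    then show "representative (MN E) (MC E) (incl E) (prj E) (\<psi> u)"
      using f.rep_N by (simp add: MN_W incl_W) (simp add: adjoin_simps)
  qed
qed

end

section \<open>Preservation of products\<close>

text \<open>The predicate \<open>Q\<close> treats both categories at once: the argument stays inside
  any full subcategory that contains \<open>adjoin e T \<beta> P\<close> together with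
  \<open>P\<close>.\<close>

lemma preserves_finite_products_D1:
  fixes M :: "'u monoid"
  assumes inf: "infinite (UNIV :: 'u set)"
    and Q: "\<And>(e :: 'u \<times> 'u \<Rightarrow> 'u) T \<beta> P. inj e \<Longrightarrow> comm_monoid T \<Longrightarrow> Q P \<Longrightarrow> Q (adjoin e T \<beta> P)"
  shows "preserves_finite_products (full_subcat (XSExt M) Q) (can_Smod M) (D1 M)"
  unfolding preserves_finite_products_def
proof (intro allI impI)
  fix I :: "nat set" and X P p
  assume "is_product (full_subcat (XSExt M) Q) I X P p"
  then have X: "\<And>i. i \<in> I \<Longrightarrow> crossed_schreier M (X i)"
    and P: "crossed_schreier M P" "Q P"
    and p': "\<And>i. i \<in> I \<Longrightarrow> p i \<in> Hom (XSExt M) P (X i)"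
    and univ: "\<And>E f. crossed_schreier M E \<Longrightarrow> Q E \<Longrightarrow>
      (\<And>i. i \<in> I \<Longrightarrow> f i \<in> Hom (XSExt M) E (X i)) \<Longrightarrow>
      \<exists>!h. h \<in> Hom (XSExt M) E P \<and> (\<forall>i \<in> I. Comp (XSExt M) E P (X i) (p i) h = f i)"
    unfolding is_product_def by (auto simp: Obj_XSExt)
  have p: "crossed_schreier_morphism M P (X i) (fst (p i)) (snd (p i))" if "i \<in> I" for i
    using p'[OF that] X[OF that] P by (simp add: Hom_XSExt_iff)
  interpret P: crossed_schreier M P by fact
  \<comment> \<open>An infinite universe is equinumerous with its square, so products of carriers
    can be encoded in it.\<close>
  obtain e :: "'u \<times> 'u \<Rightarrow> 'u" where "bij_betw e (UNIV \<times> UNIV) UNIV"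
    using card_of_Times_same_infinite[OF inf] card_of_ordIso by blast
  then have e: "inj e" by (simp add: bij_betw_def)
  have universal: "\<exists>!h. h \<in> Hom (can_Smod M) Y (FOb (D1 M) P) \<and>
      (\<forall>i \<in> I. Comp (can_Smod M) Y (FOb (D1 M) P) (FOb (D1 M) (X i)) (FAr (D1 M) P (X i) (p i)) h = t i)"
    if Y: "Y \<in> Obj (can_Smod M)" and t: "\<forall>i \<in> I. t i \<in> Hom (can_Smod M) Y (FOb (D1 M) (X i))" for Y t
  proof -
    obtain T \<beta> where Y_eq: "Y = (T, \<beta>)" by (cases Y)
    interpret semimodule_adjunct M P e T \<beta>
      using Y by (intro semimodule_adjunct.intro semimodule_adjunct_axioms.intro P.crossed_schreier_axioms e)
        (simp_all add: Y_eq Obj_can_Smod)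
    interpret W: crossed_schreier M W by (rule crossed_schreier_W)
    have QW: "Q W" using Q e P T.comm_monoid_axioms by blast
    have t_hom: "t i \<in> mhom T (MA (X i))"
      and t_equiv: "\<And>m a. m \<in> carrier M \<Longrightarrow> a \<in> carrier T \<Longrightarrow>
        t i (\<beta> m a) = induced_action M (X i) m (t i a)" if "i \<in> I" for i
      using t that by (auto simp: Y_eq Hom_can_Smod D1_def)
    \<comment> \<open>The given cone over the semimodules, extended to a cone over the
      \<open>X i\<close> with vertex \<open>W\<close>.\<close>
    define f where "f i = (ext_map e T P (X i) (t i) (fst (p i)), snd (p i))" for i
    have f: "f i \<in> Hom (XSExt M) W (X i)" if "i \<in> I" for i
      using ext_map_morphism[OF p t_hom t_equiv] that X
      by (simp add: f_def Hom_XSExt_iff W.crossed_schreier_axioms)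
    from univ[OF W.crossed_schreier_axioms QW f]
    obtain H where H: "H \<in> Hom (XSExt M) W P"
      and pH: "\<And>i. i \<in> I \<Longrightarrow> Comp (XSExt M) W P (X i) (p i) H = f i"
      and H_unique: "\<And>H'. H' \<in> Hom (XSExt M) W P \<Longrightarrow>
        (\<And>i. i \<in> I \<Longrightarrow> Comp (XSExt M) W P (X i) (p i) H' = f i) \<Longrightarrow> H' = H"
      by metis
    interpret H: crossed_schreier_morphism M W P "fst H" "snd H"
      using H by (simp add: Hom_XSExt_iff W.crossed_schreier_axioms P)
    \<comment> \<open>The map induced on kernels by \<open>H\<close>, restricted to the copy of
      \<open>T\<close> in the kernel of \<open>W\<close>.\<close>
    define h where "h = (\<lambda>a \<in> carrier T. star_A W P (fst H) (e (a, \<one>\<^bsub>MA P\<^esub>)))"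
    have h_closed: "h a \<in> carrier (MA P)" if "a \<in> carrier T" for a
      using that by (simp add: h_def H.star_A_closed adjoin_simps)
    have ker_h: "ker P (h a) = fst H (e (a, \<one>\<^bsub>MB P\<^esub>))" if "a \<in> carrier T" for a
      using that by (simp add: h_def H.ker_star_A adjoin_simps)
    have h_hom: "h \<in> mhom T (MA P)"
    proof (rule mhomI)
      fix a b assume ab: "a \<in> carrier T" "b \<in> carrier T"
      then show "h (a \<otimes>\<^bsub>T\<^esub> b) = h a \<otimes>\<^bsub>MA P\<^esub> h b"
        using mhom_mult[OF H.star_A_hom, of "e (a, \<one>\<^bsub>MA P\<^esub>)" "e (b, \<one>\<^bsub>MA P\<^esub>)"]
        by (simp add: h_def adjoin_simps monoid.l_one[OF P.monoid_A])
    next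
      show "h \<one>\<^bsub>T\<^esub> = \<one>\<^bsub>MA P\<^esub>"
        using mhom_one[OF H.star_A_hom] by (simp add: h_def adjoin_simps)
    qed (simp_all add: h_closed, simp add: h_def)
    \<comment> \<open>For \<open>c\<close> over \<open>m\<close>, the action of \<open>c\<close> on
      \<open>W\<close> sends \<open>e (a, \<one>)\<close> to \<open>e (\<beta> m a, \<one>)\<close>,
      and \<open>snd H c\<close> still lies over \<open>m\<close>.\<close>
    have h_equiv: "h (\<beta> m a) = induced_action M P m (h a)"
      if m: "m \<in> carrier M" and a: "a \<in> carrier T" for m a
    proof -
      obtain c where c: "c \<in> carrier (MC P)" "prj P c = m" using P.prj_surj[OF m] .
      then have cW: "c \<in> carrier (MC W)" "snd H c \<in> carrier (MC P)" "prj P (snd H c) = m"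
        using H.prj_map[of c] by (simp_all add: adjoin_simps mhom_closed[OF H.psi_hom])
      have "ker P (h (\<beta> m a)) = fst H (act W c (e (a, \<one>\<^bsub>MB P\<^esub>)))"
        using m a c by (simp add: ker_h)
      also have "\<dots> = act P (snd H c) (ker P (h a))"
        using H.act_map[of c "e (a, \<one>\<^bsub>MB P\<^esub>)"] a cW by (simp add: ker_h adjoin_simps)
      also have "\<dots> = ker P (induced_action M P m (h a))"
        using P.ker_induced_action[of "snd H c" "h a"] a cW h_closed by simp
      finally show ?thesis
        using P.induced_action_closed[of "snd H c" "h a"] a m cW h_closed by (simp add: P.ker_eq_iff)
    qed
    \<comment> \<open>Evaluating the factorisation of \<open>f i\<close> through \<open>H\<close> at
      \<open>e (a, \<one>)\<close> leaves only the kernel part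
      \<open>ker (X i) (t i a)\<close>.\<close>
    have star_h: "compose (carrier T) (star_A P (X i) (fst (p i))) h = t i" if i: "i \<in> I" for i
    proof (rule extensionalityI[of _ "carrier T"])
      interpret p: crossed_schreier_morphism M P "X i" "fst (p i)" "snd (p i)" by (rule p[OF i])
      fix a assume a: "a \<in> carrier T"
      have "fst (p i) (fst H (e (a, \<one>\<^bsub>MB P\<^esub>))) = fst (f i) (e (a, \<one>\<^bsub>MB P\<^esub>))"
        using a by (simp add: Comp_XSExt adjoin_simps compose_eq flip: pH[OF i])
      also have "\<dots> = ker (X i) (t i a)"
        using a by (simp add: f_def ext_map_eq mhom_one[OF p.phi_hom] monoid.r_one[OF p.tgt.monoid_B]
            mhom_closed[OF t_hom[OF i]])
      finally show "compose (carrier T) (star_A P (X i) (fst (p i))) h a = t i a"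
        using a by (simp add: compose_eq p.star_A_eqI h_closed ker_h mhom_closed[OF t_hom[OF i]])
    qed (simp_all add: mhom_extensional[OF t_hom[OF i]])
    have h_unique: "h' = h"
      if h': "h' \<in> mhom T (MA P)"
        and equiv: "\<And>m a. m \<in> carrier M \<Longrightarrow> a \<in> carrier T \<Longrightarrow> h' (\<beta> m a) = induced_action M P m (h' a)"
        and comp: "\<And>i. i \<in> I \<Longrightarrow> compose (carrier T) (star_A P (X i) (fst (p i))) h' = t i" for h'
    proof -
      \<comment> \<open>Extending \<open>h'\<close> along the identity of \<open>P\<close> makes the
        second components match as well: composing with \<open>p i\<close> gives
        \<open>snd (p i)\<close>, the second component of \<open>f i\<close>.\<close>
      define \<iota> where "\<iota> = Ident (XSExt M) P"
      have "crossed_schreier_morphism M P P (fst \<iota>) (snd \<iota>)"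
        using xsext_morphism_id[OF P(1)]
        by unfold_locales (simp add: \<iota>_def Ident_XSExt)
      then have mor: "crossed_schreier_morphism M W P (ext_map e T P P h' (fst \<iota>)) (snd \<iota>)"
        by (rule ext_map_morphism[OF _ h' equiv])
      have "(ext_map e T P P h' (fst \<iota>), snd \<iota>) = H"
      proof (rule H_unique)
        show "(ext_map e T P P h' (fst \<iota>), snd \<iota>) \<in> Hom (XSExt M) W P"
          using mor by (simp add: Hom_XSExt_iff W.crossed_schreier_axioms P)
        fix i assume i: "i \<in> I"
        interpret p: crossed_schreier_morphism M P "X i" "fst (p i)" "snd (p i)" by (rule p[OF i])
        have star: "fst (p i) (ker P (h' a)) = ker (X i) (t i a)" if "a \<in> carrier T" for a
          using that comp[OF i] p.ker_star_A[of "h' a"] mhom_closed[OF h' that] by (metis compose_eq)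
        have "compose (carrier (MB W)) (fst (p i)) (ext_map e T P P h' (fst \<iota>))
          = ext_map e T P (X i) (t i) (fst (p i))"
        proof (rule extensionalityI[of _ "carrier (MB W)"])
          fix x assume "x \<in> carrier (MB W)"
          then show "compose (carrier (MB W)) (fst (p i)) (ext_map e T P P h' (fst \<iota>)) x
            = ext_map e T P (X i) (t i) (fst (p i)) x"
            by (auto simp: compose_eq adjoin_simps ext_map_eq \<iota>_def Ident_XSExt mhom_closed[OF h']
                mhom_mult[OF p.phi_hom] star elim!: W_cases)
        qed (simp_all add: ext_map_def adjoin_simps)
        moreover have "compose (carrier (MC W)) (snd (p i)) (snd \<iota>) = snd (p i)"
          by (simp add: \<iota>_def Ident_XSExt adjoin_simps compose_restrict_id mhom_extensional[OF p.psi_hom])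
        ultimately show "Comp (XSExt M) W P (X i) (p i) (ext_map e T P P h' (fst \<iota>), snd \<iota>) = f i"
          by (simp add: Comp_XSExt f_def)
      qed
      then have fst_H: "fst H = ext_map e T P P h' (fst \<iota>)" by auto
      show "h' = h"
      proof (rule mhom_eqI[OF h' h_hom])
        \<comment> \<open>At \<open>e (a, \<one>)\<close> the common morphism takes the value
          \<open>ker P (h' a)\<close> by the extension formula and \<open>ker P (h a)\<close> by the
          definition of \<open>h\<close>.\<close>
        fix a assume a: "a \<in> carrier T"
        then have "ker P (h' a) = ker P (h a)"
          by (simp add: ker_h fst_H ext_map_eq \<iota>_def Ident_XSExt monoid.r_one[OF P.monoid_B]
              mhom_closed[OF h'])
        then show "h' a = h a"
          using a by (simp add: P.ker_eq_iff h_closed mhom_closed[OF h'])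
      qed
    qed
    show ?thesis
      by (rule ex1I[of _ h])
        (auto simp: Y_eq Hom_can_Smod Comp_can_Smod D1_def case_prod_beta h_hom h_equiv star_h
          intro!: h_unique)
  qed
  have D: "\<And>i. i \<in> I \<Longrightarrow> FOb (D1 M) (X i) \<in> Obj (can_Smod M)" "FOb (D1 M) P \<in> Obj (can_Smod M)"
    "\<And>i. i \<in> I \<Longrightarrow> FAr (D1 M) P (X i) (p i) \<in> Hom (can_Smod M) (FOb (D1 M) P) (FOb (D1 M) (X i))"
    using is_functor_D1[of M] X P p' unfolding is_functor_def by (auto simp: Obj_XSExt)
  then show "is_product (can_Smod M) I (\<lambda>i. FOb (D1 M) (X i)) (FOb (D1 M) P)
      (\<lambda>i. FAr (D1 M) P (X i) (p i))"
    unfolding is_product_def using universal by blast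
qed

theorem proposition5p2:
  fixes M :: "'u monoid"
  assumes "infinite (UNIV :: 'u set)"
    and "monoid M"
  shows "is_functor (XSExt M) (can_Smod M) (D1 M)
       \<and> preserves_finite_products (XSExt M) (can_Smod M) (D1 M)
       \<and> is_functor (com_XSExt M) (can_Smod M) (D1 M)
       \<and> preserves_finite_products (com_XSExt M) (can_Smod M) (D1 M)"
proof -
  \<comment> \<open>The whole category is the full subcategory cut out by the constantly true
    predicate.\<close>
  have "full_subcat (XSExt M) (\<lambda>_. True) = XSExt M"
    by (simp add: full_subcat_def)
  moreover have "preserves_finite_products (full_subcat (XSExt M) (\<lambda>_. True)) (can_Smod M) (D1 M)"
    by (rule preserves_finite_products_D1[OF assms(1)])
  ultimately have "preserves_finite_products (XSExt M) (can_Smod M) (D1 M)"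
    by (rule subst)
  moreover have "preserves_finite_products (com_XSExt M) (can_Smod M) (D1 M)"
    unfolding com_XSExt_def
    by (rule preserves_finite_products_D1[OF assms(1)])
      (simp add: adjoin_simps comm_monoid_pair_monoid)
  ultimately show ?thesis
    using is_functor_D1[of M] is_functor_full_subcat[OF is_functor_D1[of M]]
    by (simp add: com_XSExt_def)
qed

end
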